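(* Let $n\ge1$ be an integer, $\alpha\in(0,2)$ and $\nu>0$. Then for every real $c$ with $0<c<\min\{\nu,\frac1\alpha\}$ and every $r>0$, $$q_{\alpha,\nu,n}(r)=\frac{r^{-n}}{\pi^{\frac n2}\Gamma(\nu)}\frac{1}{2\pi i}\int_{c-i\infty}^{c+i\infty}f_{\alpha,\nu,n}(w;r)\,dw,$$ where $$f_{\alpha,\nu,n}(w;r)=\Gamma(w)\Gamma(\nu-w)\left(\frac r2\right)^{\alpha w}\frac{\Gamma\left(\frac{n-\alpha w}{2}\right)}{\Gamma\left(\frac{\alpha w}{2}\right)}.$$
   Context: $\Vert\cdot\Vert$ is the Euclidean norm on $\mathbb{R}^n$. For an integer $n\ge1$, $\alpha\in(0,2]$, $\nu>0$, $p_{\alpha,\nu,n}$ denotes the probability density function on $\mathbb{R}^n$ whose characteristic function is $\int_{\mathbb{R}^n}e^{i\mathbf{x}\cdot\boldsymbol{t}}p_{\alpha,\nu,n}(\mathbf{x})\,d^n\mathbf{x}=(1+\Vert\boldsymbol{t}\Vert^\alpha)^{-\nu}$ for all $\boldsymbol{t}\in\mathbb{R}^n$. It is a radial function; one takes the version which is continuous on $\mathbb{R}^n\setminus\{\mathbf{0}\}$, and $q_{\alpha,\nu,n}(r)$, $r>0$, denotes the value of $p_{\alpha,\nu,n}(\mathbf{x})$ at points with $\Vert\mathbf{x}\Vert=r$. The integral is along the vertical line $\mathrm{Re}\,w=c$. *)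

theory Defs
  imports "HOL-Probability.Probability"
begin

text \<open>
  A density is determined by its characteristic function only up to null sets; the last conjunct
  selects the version that is continuous off the origin, which fixes \<open>p\<close> everywhere except at \<open>0\<close>
  (where the continuous version may be unbounded and the value of \<open>p\<close> is irrelevant).
\<close>
definition is_linnik_density :: "real \<Rightarrow> real \<Rightarrow> (real ^ 'n \<Rightarrow> real) \<Rightarrow> bool" where
  "is_linnik_density \<alpha> \<nu> p \<longleftrightarrow>
     p \<in> borel_measurable borel \<and>
     (\<forall>x. 0 \<le> p x) \<and>
     prob_space (density lborel (\<lambda>x. ennreal (p x))) \<and>
     (\<forall>t. (LINT x|lborel. exp (\<i> * complex_of_real (x \<bullet> t)) * complex_of_real (p x)) =
          complex_of_real ((1 + norm t powr \<alpha>) powr (- \<nu>))) \<and>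
     continuous_on (- {0}) p"

definition linnik_integrand :: "real \<Rightarrow> real \<Rightarrow> nat \<Rightarrow> real \<Rightarrow> complex \<Rightarrow> complex" where
  "linnik_integrand \<alpha> \<nu> n r w =
     Gamma w * Gamma (complex_of_real \<nu> - w) *
     complex_of_real (r / 2) powr (complex_of_real \<alpha> * w) *
     (Gamma ((of_nat n - complex_of_real \<alpha> * w) / 2) / Gamma (complex_of_real \<alpha> * w / 2))"

text \<open>
  With \<open>w = c + \<i> y\<close> one has \<open>dw = \<i> dy\<close>; the integral is an absolutely convergent (Lebesgue)
  integral over \<open>y\<close>, and its existence has to be stated separately.
\<close>
definition vertical_line_integrable :: "real \<Rightarrow> (complex \<Rightarrow> complex) \<Rightarrow> bool" where
  "vertical_line_integrable c f \<longleftrightarrow> integrable lborel (\<lambda>y. f (Complex c y))"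

definition vertical_line_integral :: "real \<Rightarrow> (complex \<Rightarrow> complex) \<Rightarrow> complex" where
  "vertical_line_integral c f = \<i> * (LINT y|lborel. f (Complex c y))"

end

theory Submission
  imports Defs
begin

text \<open>
  Put \<open>w = c + \<i> y\<close>, \<open>z = \<alpha> w / 2\<close>, and let \<open>n\<close> be the dimension. The Beta integral says that
  \<open>\<Gamma>(w) \<Gamma>(\<nu> - w) / \<Gamma>(\<nu>)\<close> is the Fourier transform in \<open>y\<close> of an explicit function; inverting it writes the
  characteristic function as a superposition of the powers \<open>|t|\<close> to the \<open>- 2 z\<close>. After multiplication by
  \<open>exp (- a |t|\<^sup>2)\<close> each of these has an absolutely convergent Fourier integral, obtained by writing the
  power as a superposition of Gaussians. As \<open>a\<close> tends to \<open>0\<close>, these integrals tend to the Riesz kernels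
  of the claim, while the Gaussian-regularised inversion integral tends to \<open>(2 \<pi>)\<^sup>n p(x)\<close> by continuity
  of \<open>p\<close> at \<open>x\<close>. The exchange of limit and integral over \<open>y\<close> rests on the exponential decay of
  \<open>\<Gamma>(w) \<Gamma>(\<nu> - w) / \<Gamma>(z)\<close>, which follows from the reflection formula at real part \<open>1/2\<close> and a comparison
  of \<open>\<Gamma>\<close> on two vertical lines.
\<close>

section \<open>The Gamma and Beta integrals in logarithmic coordinates\<close>

text \<open>The substitution t = exp s in Euler's integral; its Jacobian raises the exponent z - 1
  to z. In this coordinate, scaling becomes translation and vertical lines in z give Fourier
  integrals in s.\<close>

lemma integrable_Gamma_exp:
  assumes "0 < Re z"
  shows integrable_exp_minus_exp: "integrable lborel (\<lambda>s. exp (z * of_real s - of_real (exp s)))"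
    and Gamma_eq_LINT_exp: "(LINT s|lborel. exp (z * of_real s - of_real (exp s))) = Gamma z"
proof -
  let ?f = "\<lambda>t. complex_of_real t powr (z - 1) / of_real (exp t)"
  let ?g = "\<lambda>s. exp (z * complex_of_real s - of_real (exp s))"
  have img: "exp ` (UNIV::real set) = {0<..}"
    by (auto simp: image_iff) (metis exp_ln)
  have eq: "(\<lambda>s. \<bar>exp s\<bar> *\<^sub>R ?f (exp s)) = ?g"
    by (rule ext)
      (simp add: powr_def Ln_of_real exp_diff exp_of_real[symmetric] scaleR_conv_of_real left_diff_distrib)
  have "(\<lambda>s. \<bar>exp s\<bar> *\<^sub>R ?f (exp s)) absolutely_integrable_on UNIV \<and>
        integral UNIV (\<lambda>s. \<bar>exp s\<bar> *\<^sub>R ?f (exp s)) = Gamma z"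
    by (subst has_absolute_integral_change_of_variables_real)
       (auto simp: img intro!: absolutely_integrable_Gamma_integral' assms derivative_eq_intros
          injI integral_unique Gamma_integral_complex' inj_onI)
  then have "?g absolutely_integrable_on UNIV" and I: "integral UNIV ?g = Gamma z"
    unfolding eq by auto
  then have *: "integrable lebesgue ?g"
    by (simp add: set_integrable_def)
  show int: "integrable lborel ?g"
    using * by (subst (asm) integrable_completion) auto
  show "integral\<^sup>L lborel ?g = Gamma z"
    using I integral_lborel[OF int] by simp
qed

text \<open>The form in which integrals are exchanged below: the majorant is integrated in one order
  only, and Tonelli for the modulus then yields joint integrability.\<close>

lemma lborel_Fubini:
  fixes f :: "'a::euclidean_space \<Rightarrow> 'b::euclidean_space \<Rightarrow> complex"
  assumes [measurable]: "(\<lambda>(x, y). f x y) \<in> borel_measurable (lborel \<Otimes>\<^sub>M lborel)"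
    and le: "\<And>x y. norm (f x y) \<le> g x y"
    and g: "\<And>x. integrable lborel (g x)"
    and G: "integrable lborel (\<lambda>x. LINT y|lborel. g x y)"
  shows "integrable (lborel \<Otimes>\<^sub>M lborel) (\<lambda>(x, y). f x y)"
    and "(LINT x|lborel. LINT y|lborel. f x y) = (LINT y|lborel. LINT x|lborel. f x y)"
proof -
  have m: "f x \<in> borel_measurable lborel" for x
  proof -
    have "(\<lambda>y. case (x, y) of (x, y) \<Rightarrow> f x y) \<in> borel_measurable lborel"
      by measurable
    then show ?thesis by simp
  qed
  have i: "integrable lborel (f x)" for x
    by (rule Bochner_Integration.integrable_bound[OF g[of x]]) (use m le in \<open>auto intro: order_trans[OF _ abs_ge_self]\<close>)
  show I: "integrable (lborel \<Otimes>\<^sub>M lborel) (\<lambda>(x, y). f x y)"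
  proof (rule lborel_pair.Fubini_integrable)
    show "integrable lborel (\<lambda>x. LINT y|lborel. norm (case (x, y) of (x, y) \<Rightarrow> f x y))"
    proof (rule Bochner_Integration.integrable_bound[OF G])
      show "AE x in lborel. norm (LINT y|lborel. norm (case (x, y) of (x, y) \<Rightarrow> f x y)) \<le> norm (LINT y|lborel. g x y)"
        using i g le by (auto intro!: AE_I2 order_trans[OF _ abs_ge_self] integral_mono)
    qed measurable
  qed (use i in auto)
  show "(LINT x|lborel. LINT y|lborel. f x y) = (LINT y|lborel. LINT x|lborel. f x y)"
    using lborel_pair.Fubini_integral[OF I] by simp
qed

lemma Gamma_neq_0: "0 < Re z \<Longrightarrow> Gamma z \<noteq> 0"
  by (auto simp: Gamma_eq_zero_iff elim!: nonpos_Ints_cases)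

text \<open>Translating s by ln q turns q exp s into exp s. The result is Gamma(z) q^(-z), with the
  power spelled out by the real logarithm; for q = |t|^2 this writes a power of |t| as a
  superposition of Gaussians.\<close>

lemma integrable_Gamma_exp_scaled:
  assumes "0 < Re z" and "0 < q"
  shows integrable_exp_minus_scaled_exp: "integrable lborel (\<lambda>s. exp (z * of_real s - of_real (q * exp s)))" (is ?I)
    and LINT_exp_minus_scaled_exp: "(LINT s|lborel. exp (z * of_real s - of_real (q * exp s))) = Gamma z * exp (- z * of_real (ln q))" (is ?L)
proof -
  let ?g = "\<lambda>s. exp (z * complex_of_real s - of_real (exp s))"
  have *: "exp (z * of_real s - of_real (q * exp s)) = exp (- z * of_real (ln q)) * ?g (ln q + 1 * s)" for s
    using \<open>0 < q\<close> by (simp add: exp_add[symmetric] exp_add algebra_simps flip: exp_of_real)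
  show ?I
    unfolding * using lborel_integrable_real_affine[OF integrable_exp_minus_exp[OF assms(1)], of 1 "ln q"]
    by simp
  have "(LINT s|lborel. ?g (ln q + 1 * s)) = Gamma z"
    using lborel_integral_real_affine[of 1 ?g "ln q"] Gamma_eq_LINT_exp[OF assms(1)] by simp
  then show ?L
    unfolding * by simp
qed

lemma integrable_Gamma_exp_scaled_real:
  fixes a q :: real
  assumes "0 < a" and "0 < q"
  shows integrable_exp_minus_scaled_exp_real: "integrable lborel (\<lambda>s. exp (a * s - q * exp s))" (is ?I)
    and LINT_exp_minus_scaled_exp_real: "(LINT s|lborel. exp (a * s - q * exp s)) = Gamma a * exp (- a * ln q)" (is ?L)
proof -
  have "complex_of_real (exp (a * s - q * exp s)) = exp (of_real a * of_real s - of_real (q * exp s))" for s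
    by (simp flip: exp_of_real)
  then have 1: "(\<lambda>s. complex_of_real (exp (a * s - q * exp s))) = (\<lambda>s. exp (of_real a * of_real s - of_real (q * exp s)))"
    by blast
  show ?I
    using integrable_exp_minus_scaled_exp[of "of_real a" q] assms unfolding 1[symmetric] complex_of_real_integrable_eq
    by simp
  have "complex_of_real (LINT s|lborel. exp (a * s - q * exp s)) = complex_of_real (Gamma a * exp (- a * ln q))"
    unfolding integral_complex_of_real[symmetric] 1
    using LINT_exp_minus_scaled_exp[of "of_real a" q] assms by (simp add: Gamma_complex_of_real flip: exp_of_real)
  then show ?L
    by (simp only: of_real_eq_iff)
qed

text \<open>With u = exp x this is the integral of u^(w-1) (1+u)^(-v) over u > 0. The double
  integral of exp(v s + w x - e^s (1 + e^x)) is computed in both orders: integrating over s first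
  gives Gamma(v) (1 + e^x)^(-v), and integrating over x first leaves a Gamma integral with parameter
  v - w.\<close>

lemma integrable_Beta_exp:
  assumes w: "0 < Re w" "Re w < Re v"
  shows integrable_Beta_kernel: "integrable lborel (\<lambda>x. exp (w * of_real x - v * of_real (ln (1 + exp x))))" (is ?I)
    and LINT_Beta_kernel: "(LINT x|lborel. exp (w * of_real x - v * of_real (ln (1 + exp x)))) = Gamma w * Gamma (v - w) / Gamma v" (is ?L)
proof -
  define f where "f = (\<lambda>s x. exp (v * complex_of_real s + w * of_real x - of_real (exp s * (1 + exp x))))"
  define g where "g = (\<lambda>s x. exp (Re v * s + Re w * x - exp s * (1 + exp x)))"
  have m: "(\<lambda>(x, y). f x y) \<in> borel_measurable (lborel \<Otimes>\<^sub>M lborel)"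
    unfolding f_def by measurable
  have fg: "norm (f s x) \<le> g s x" for s x
    by (simp add: f_def g_def)
  have f1: "f s x = exp (v * of_real s - of_real (exp s)) * exp (w * of_real x - of_real (exp s * exp x))" for s x
    by (simp add: f_def exp_add[symmetric] algebra_simps)
  have f2: "f s x = exp (w * of_real x) * exp (v * of_real s - of_real ((1 + exp x) * exp s))" for s x
    by (simp add: f_def exp_add[symmetric] algebra_simps)
  have g1: "g s x = exp (Re v * s - exp s) * exp (Re w * x - exp s * exp x)" for s x
    by (simp add: g_def exp_add[symmetric] algebra_simps)
  have gi: "integrable lborel (g s)" for s
    unfolding g1 using w by (intro integrable_mult_right integrable_exp_minus_scaled_exp_real) auto
  have gl: "(LINT x|lborel. g s x) = Gamma (Re w) * exp ((Re v - Re w) * s - 1 * exp s)" for s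
    unfolding g1 integral_mult_right_zero using w LINT_exp_minus_scaled_exp_real[of "Re w" "exp s"]
    by (simp add: exp_add[symmetric] algebra_simps)
  have gG: "integrable lborel (\<lambda>s. LINT x|lborel. g s x)"
    unfolding gl using w by (intro integrable_mult_right integrable_exp_minus_scaled_exp_real) auto
  have fx: "(LINT s|lborel. f s x) = Gamma v * exp (w * of_real x - v * of_real (ln (1 + exp x)))" for x
    unfolding f2 integral_mult_right_zero using w
    by (subst LINT_exp_minus_scaled_exp) (auto simp: add_pos_pos exp_diff exp_minus divide_simps)
  have fs: "(LINT x|lborel. f s x) = Gamma w * exp ((v - w) * of_real s - of_real (exp s))" for s
    unfolding f1 integral_mult_right_zero using w LINT_exp_minus_scaled_exp[of w "exp s"]
    by (simp add: exp_add[symmetric] algebra_simps)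
  have Gv: "Gamma v \<noteq> 0"
    using w by (intro Gamma_neq_0) simp
  have "integrable lborel (\<lambda>x. LINT s|lborel. f s x)"
    by (rule lborel_pair.integrable_snd[OF lborel_Fubini(1)[OF m fg gi gG]])
  then have "integrable lborel (\<lambda>x. (1 / Gamma v) * (LINT s|lborel. f s x))"
    by (intro integrable_mult_right)
  then show ?I
    using Gv unfolding fx by simp
  have "Gamma v * (LINT x|lborel. exp (w * of_real x - v * of_real (ln (1 + exp x)))) = Gamma w * Gamma (v - w)"
    using lborel_Fubini(2)[OF m fg gi gG] Gamma_eq_LINT_exp[of "v - w"] w unfolding fx fs by simp
  then show ?L
    using Gv by (simp add: field_simps)
qed

lemma integrable_Beta_exp_real:
  fixes a b :: real
  assumes ab: "0 < a" "a < b"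
  shows integrable_Beta_kernel_real: "integrable lborel (\<lambda>x. exp (a * x - b * ln (1 + exp x)))" (is ?I)
    and LINT_Beta_kernel_real: "(LINT x|lborel. exp (a * x - b * ln (1 + exp x))) = Gamma a * Gamma (b - a) / Gamma b" (is ?L)
proof -
  have 1: "(\<lambda>x. complex_of_real (exp (a * x - b * ln (1 + exp x)))) =
      (\<lambda>x. exp (of_real a * of_real x - of_real b * of_real (ln (1 + exp x))))"
    by (rule ext) (simp flip: exp_of_real)
  show ?I
    using integrable_Beta_kernel[of "of_real a" "of_real b"] ab
    unfolding 1[symmetric] complex_of_real_integrable_eq by simp
  have "complex_of_real (LINT x|lborel. exp (a * x - b * ln (1 + exp x))) = of_real (Gamma a * Gamma (b - a) / Gamma b)"
    unfolding integral_complex_of_real[symmetric] 1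
    using LINT_Beta_kernel[of "of_real a" "of_real b"] ab
    by (simp add: Gamma_complex_of_real flip: of_real_diff)
  then show ?L
    by (simp only: of_real_eq_iff)
qed

section \<open>Size of Gamma along vertical lines\<close>

text \<open>Gamma(a-b) Gamma(b+is) / Gamma(a+is) is a Beta integral with real w = a - b and v = a +
  is. The modulus of its integrand does not depend on s, so the triangle inequality bounds it by its
  value at s = 0.\<close>

lemma norm_Gamma_le_vertical:
  assumes "0 < b" "b < a"
  shows "norm (Gamma (Complex b s)) \<le> Gamma b / Gamma a * norm (Gamma (Complex a s))"
proof -
  let ?w = "complex_of_real (a - b)" and ?v = "Complex a s"
  have nz: "Gamma ?v \<noteq> 0"
    using assms by (intro Gamma_neq_0) simp
  have pos: "0 < Gamma a" "0 < Gamma (a - b)"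
    using assms by (auto intro: Gamma_real_pos)
  have vw: "?v - ?w = Complex b s"
    by (simp add: complex_eq_iff)
  have "norm (Gamma ?w * Gamma (?v - ?w) / Gamma ?v) \<le>
      (LINT x|lborel. norm (exp (?w * of_real x - ?v * of_real (ln (1 + exp x)))))"
    using LINT_Beta_kernel[of ?w ?v] assms integral_norm_bound[of lborel "\<lambda>x. exp (?w * of_real x - ?v * of_real (ln (1 + exp x)))"] by simp
  also have "\<dots> = Gamma (a - b) * Gamma b / Gamma a"
    using LINT_Beta_kernel_real[of "a - b" a] assms by simp
  finally have "Gamma (a - b) * norm (Gamma (Complex b s)) / norm (Gamma ?v) \<le> Gamma (a - b) * Gamma b / Gamma a"
    unfolding vw using pos by (simp add: norm_mult norm_divide Gamma_complex_of_real del: of_real_diff)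
  then have "Gamma (a - b) * norm (Gamma (Complex b s)) \<le> Gamma (a - b) * (Gamma b / Gamma a * norm (Gamma ?v))"
    using nz pos by (simp add: divide_simps mult_ac)
  then show ?thesis
    using pos by (simp only: mult_le_cancel_left_pos)
qed

text \<open>This carries the explicit size of Gamma at real part 1/2 to every line in the right half
  plane, in either direction. The loss exp(e|s|) is tolerable because the exponential rates needed
  later leave a margin.\<close>

lemma norm_Gamma_compare:
  assumes "0 < a" "0 < b" "0 < e"
  obtains C where "0 < C" "\<And>s. norm (Gamma (Complex a s)) \<le> C * exp (e * \<bar>s\<bar>) * norm (Gamma (Complex b s))"
proof -
  \<comment> \<open>The functional equation raises \<open>b\<close> by integers at polynomial cost; \<open>a < b + k\<close> is monotonicity.\<close>
  have step: "\<exists>C>0. \<forall>s. norm (Gamma (Complex (b + real k) s)) \<le> C * exp (e * \<bar>s\<bar>) * norm (Gamma (Complex b s))"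
    if "0 < e" for k and e :: real
    using that
  proof (induction k arbitrary: e)
    case 0
    then show ?case by (intro exI[of _ 1]) (auto simp: mult_le_cancel_right1)
  next
    case (Suc k)
    \<comment> \<open>Half of \<open>e\<close> is spent on the induction hypothesis, the other half
      on the new linear factor; this is why the induction generalises over \<open>e\<close>.\<close>
    from Suc.IH[of "e / 2"] Suc.prems obtain C where C: "0 < C"
      "\<And>s. norm (Gamma (Complex (b + real k) s)) \<le> C * exp (e / 2 * \<bar>s\<bar>) * norm (Gamma (Complex b s))"
      by auto
    \<comment> \<open>\<open>b + real k\<close> accounts for the real part of the new factor, and
      \<open>2 / e\<close> comes from |s| \<le> (2/e) exp(e|s|/2).\<close>
    define D where "D = b + real k + 2 / e"
    have D: "0 < D" using assms Suc.prems by (simp add: D_def add_pos_nonneg)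
    have "norm (Gamma (Complex (b + real (Suc k)) s)) \<le> D * C * exp (e * \<bar>s\<bar>) * norm (Gamma (Complex b s))" for s
    proof -
      let ?z = "Complex (b + real k) s"
      have "?z \<noteq> 0" using assms by (auto simp: complex_eq_iff)
      have "Complex (b + real (Suc k)) s = ?z + 1" by (simp add: complex_eq_iff)
      moreover have "Gamma (?z + 1) = ?z * Gamma ?z"
        using assms by (intro Gamma_plus1) (auto simp: complex_eq_iff elim!: nonpos_Ints_cases)
      ultimately have "norm (Gamma (Complex (b + real (Suc k)) s)) = norm ?z * norm (Gamma ?z)"
        by (simp add: norm_mult)
      also have "norm ?z \<le> (b + real k) + \<bar>s\<bar>"
        using cmod_le[of ?z] assms by simp
      also have "\<dots> \<le> D * exp (e / 2 * \<bar>s\<bar>)"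
      proof -
        have 1: "1 + e / 2 * \<bar>s\<bar> \<le> exp (e / 2 * \<bar>s\<bar>)" by (rule exp_ge_add_one_self)
        have 2: "1 \<le> exp (e / 2 * \<bar>s\<bar>)" using Suc.prems by simp
        have "\<bar>s\<bar> = 2 / e * (e / 2 * \<bar>s\<bar>)" using Suc.prems by simp
        also have "\<dots> \<le> 2 / e * exp (e / 2 * \<bar>s\<bar>)"
          using Suc.prems order_trans[OF _ 1, of "e / 2 * \<bar>s\<bar>"] by (intro mult_left_mono) auto
        finally have "\<bar>s\<bar> \<le> 2 / e * exp (e / 2 * \<bar>s\<bar>)" .
        moreover have "b + real k \<le> (b + real k) * exp (e / 2 * \<bar>s\<bar>)"
          using 2 assms by (intro mult_le_cancel_left1[THEN iffD2]) auto
        ultimately show ?thesis by (simp add: D_def algebra_simps)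
      qed
      finally have "norm (Gamma (Complex (b + real (Suc k)) s)) \<le> D * exp (e / 2 * \<bar>s\<bar>) * norm (Gamma ?z)"
        by (simp add: mult_right_mono)
      also have "\<dots> \<le> D * exp (e / 2 * \<bar>s\<bar>) * (C * exp (e / 2 * \<bar>s\<bar>) * norm (Gamma (Complex b s)))"
        using D C by (intro mult_left_mono) auto
      also have "\<dots> = D * C * (exp (e / 2 * \<bar>s\<bar>) * exp (e / 2 * \<bar>s\<bar>)) * norm (Gamma (Complex b s))"
        by (simp only: mult_ac)
      also have "exp (e / 2 * \<bar>s\<bar>) * exp (e / 2 * \<bar>s\<bar>) = exp (e * \<bar>s\<bar>)"
        by (simp flip: exp_add)
      finally show ?thesis .
    qed
    then show ?case using D C by (intro exI[of _ "D * C"]) auto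
  qed
  obtain k :: nat where k: "a < b + real k"
    using reals_Archimedean2[of "a - b"] by (auto simp: algebra_simps)
  from step[OF \<open>0 < e\<close>, of k] obtain C where C: "0 < C"
    "\<And>s. norm (Gamma (Complex (b + real k) s)) \<le> C * exp (e * \<bar>s\<bar>) * norm (Gamma (Complex b s))"
    by auto
  define R where "R = Gamma a / Gamma (b + real k)"
  have R: "0 < R" using assms by (simp add: R_def Gamma_real_pos)
  show ?thesis
  proof
    show "0 < R * C" using R C by simp
    fix s
    have "norm (Gamma (Complex a s)) \<le> R * norm (Gamma (Complex (b + real k) s))"
      using norm_Gamma_le_vertical[of a "b + real k" s] assms k by (simp add: R_def)
    also have "\<dots> \<le> R * (C * exp (e * \<bar>s\<bar>) * norm (Gamma (Complex b s)))"
      using R C by (intro mult_left_mono) auto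
    finally show "norm (Gamma (Complex a s)) \<le> R * C * exp (e * \<bar>s\<bar>) * norm (Gamma (Complex b s))"
      by (simp add: mult_ac)
  qed
qed

lemma norm_Gamma_half: "norm (Gamma (Complex (1/2) s)) ^ 2 = pi / cosh (pi * s)"
proof -
  let ?z = "Complex (1/2) s"
  have "1 - ?z = cnj ?z" by (simp add: complex_eq_iff)
  then have "Gamma ?z * cnj (Gamma ?z) = of_real pi / sin (of_real pi * ?z)"
    using Gamma_reflection_complex[of ?z] by (simp add: cnj_Gamma)
  also have "of_real pi * ?z = of_real (pi / 2) + \<i> * of_real (pi * s)"
    by (simp add: complex_eq_iff)
  also have "sin (of_real (pi / 2) + \<i> * of_real (pi * s)) = cos (\<i> * complex_of_real (pi * s))"
    by (simp add: sin_add sin_of_real cos_of_real del: of_real_mult of_real_divide)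
  also have "\<dots> = of_real (cosh (pi * s))"
    by (simp add: cosh_conv_cos[symmetric] cosh_field_def exp_minus exp_of_real del: of_real_mult)
  also have "of_real pi / of_real (cosh (pi * s)) = complex_of_real (pi / cosh (pi * s))" by simp
  finally have "complex_of_real (norm (Gamma ?z) ^ 2) = complex_of_real (pi / cosh (pi * s))"
    by (simp only: complex_norm_square[symmetric])
  then show ?thesis by (simp only: of_real_eq_iff)
qed

lemma norm_Gamma_half_le: "norm (Gamma (Complex (1/2) s)) \<le> sqrt (2 * pi) * exp (- (pi / 2) * \<bar>s\<bar>)"
proof (rule power2_le_imp_le)
  have "exp (pi * \<bar>s\<bar>) \<le> 2 * cosh (pi * s)"
    by (cases "0 \<le> s") (auto simp: cosh_field_def abs_if mult_le_0_iff)
  then have "pi / cosh (pi * s) \<le> 2 * pi * exp (- (pi * \<bar>s\<bar>))"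
    by (simp add: exp_minus divide_simps)
  also have "\<dots> = (sqrt (2 * pi) * exp (- (pi / 2) * \<bar>s\<bar>))\<^sup>2"
    by (simp add: power_mult_distrib flip: exp_double)
  finally show "(norm (Gamma (Complex (1/2) s)))\<^sup>2 \<le> (sqrt (2 * pi) * exp (- (pi / 2) * \<bar>s\<bar>))\<^sup>2"
    by (simp add: norm_Gamma_half)
qed auto

lemma norm_Gamma_half_ge: "exp (- (pi / 2) * \<bar>s\<bar>) \<le> norm (Gamma (Complex (1/2) s))"
proof (rule power2_le_imp_le)
  have "cosh (pi * s) \<le> exp (pi * \<bar>s\<bar>)"
    by (cases "0 \<le> s") (auto simp: cosh_field_def abs_if mult_le_0_iff)
  then have "exp (- (pi * \<bar>s\<bar>)) \<le> 1 / cosh (pi * s)"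
    by (simp add: exp_minus divide_simps)
  also have "\<dots> \<le> pi / cosh (pi * s)"
    using pi_gt3 by (intro divide_right_mono) auto
  finally show "(exp (- (pi / 2) * \<bar>s\<bar>))\<^sup>2 \<le> (norm (Gamma (Complex (1/2) s)))\<^sup>2"
    by (simp add: norm_Gamma_half flip: exp_double)
qed auto

lemma norm_Gamma_vertical_le:
  assumes "0 < a" "0 < e"
  obtains C where "0 < C" "\<And>s. norm (Gamma (Complex a s)) \<le> C * exp ((e - pi / 2) * \<bar>s\<bar>)"
proof -
  obtain C where C: "0 < C" "\<And>s. norm (Gamma (Complex a s)) \<le> C * exp (e * \<bar>s\<bar>) * norm (Gamma (Complex (1/2) s))"
    using norm_Gamma_compare[of a "1/2" e] assms by auto
  have "norm (Gamma (Complex a s)) \<le> C * sqrt (2 * pi) * exp ((e - pi / 2) * \<bar>s\<bar>)" for s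
  proof -
    have "C * exp (e * \<bar>s\<bar>) * norm (Gamma (Complex (1/2) s)) \<le> C * exp (e * \<bar>s\<bar>) * (sqrt (2 * pi) * exp (- (pi / 2) * \<bar>s\<bar>))"
      using C norm_Gamma_half_le[of s] by (intro mult_left_mono) auto
    also have "\<dots> = C * sqrt (2 * pi) * (exp (e * \<bar>s\<bar>) * exp (- (pi / 2) * \<bar>s\<bar>))"
      by (simp only: mult_ac)
    also have "exp (e * \<bar>s\<bar>) * exp (- (pi / 2) * \<bar>s\<bar>) = exp ((e - pi / 2) * \<bar>s\<bar>)"
      by (simp add: algebra_simps flip: exp_add)
    finally show ?thesis using C(2)[of s] by linarith
  qed
  then show thesis using that[of "C * sqrt (2 * pi)"] C(1) by simp
qed

text \<open>The comparison with the two lines exchanged, combined with the lower bound at real part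
  1/2.\<close>

lemma norm_inverse_Gamma_vertical_le:
  assumes "0 < a" "0 < e"
  obtains C where "0 < C" "\<And>s. norm (inverse (Gamma (Complex a s))) \<le> C * exp ((e + pi / 2) * \<bar>s\<bar>)"
proof -
  obtain C where C: "0 < C" "\<And>s. norm (Gamma (Complex (1/2) s)) \<le> C * exp (e * \<bar>s\<bar>) * norm (Gamma (Complex a s))"
    using norm_Gamma_compare[of "1/2" a e] assms by auto
  have "norm (inverse (Gamma (Complex a s))) \<le> C * exp ((e + pi / 2) * \<bar>s\<bar>)" for s
  proof -
    have "Gamma (Complex a s) \<noteq> 0"
      using assms by (intro Gamma_neq_0) simp
    moreover have "exp (- (pi / 2) * \<bar>s\<bar>) \<le> C * exp (e * \<bar>s\<bar>) * norm (Gamma (Complex a s))"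
      using norm_Gamma_half_ge[of s] C(2)[of s] by linarith
    moreover have "exp ((e + pi / 2) * \<bar>s\<bar>) = exp (e * \<bar>s\<bar>) * exp (pi / 2 * \<bar>s\<bar>)"
      by (simp add: algebra_simps flip: exp_add)
    ultimately show ?thesis
      by (simp add: norm_inverse norm_divide divide_simps exp_minus mult_ac)
  qed
  then show thesis using that[of C] C(1) by simp
qed

section \<open>Gaussian regularisation of Fourier inversion\<close>

lemma LINT_gaussian_fourier_real_line:
  fixes a b :: real
  assumes "0 < a"
  shows "integrable lborel (\<lambda>s. of_real (exp (- (a * s\<^sup>2))) * exp (- \<i> * of_real (b * s)))" (is ?I)
    and "(LINT s|lborel. of_real (exp (- (a * s\<^sup>2))) * exp (- \<i> * of_real (b * s))) =
      complex_of_real (sqrt (pi / a) * exp (- (b\<^sup>2 / (4 * a))))" (is ?L)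
proof -
  \<comment> \<open>The scale for which a s^2 = (c s)^2 / 2, so that the integral becomes the
    characteristic function of the standard normal law at the rescaled frequency
    \<open>t\<close>.\<close>
  define c where "c = sqrt (2 * a)"
  define t where "t = - b / c"
  have c: "0 < c" "c\<^sup>2 = 2 * a" using assms by (simp_all add: c_def)
  let ?g = "\<lambda>x. of_real (exp (- (x\<^sup>2 / 2))) * exp (\<i> * complex_of_real (t * x))"
  have ge: "?g = (\<lambda>x. of_real (sqrt (2 * pi)) * (std_normal_density x *\<^sub>R iexp (t * x)))"
    by (rule ext) (simp add: std_normal_density_def scaleR_conv_of_real)
  have gi: "integrable lborel ?g"
  proof -
    have "integrable lborel (\<lambda>x. std_normal_density x *\<^sub>R iexp (t * x))"
      by (rule Bochner_Integration.integrable_bound[OF integrable_normal_density[of 1 0]])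
         (auto simp: normal_density_nonneg)
    then show ?thesis unfolding ge by (rule integrable_mult_right)
  qed
  have "(LINT x|lborel. std_normal_density x *\<^sub>R iexp (t * x)) = char std_normal_distribution t"
    unfolding char_def by (subst integral_density) (auto simp: normal_density_nonneg)
  then have gL: "integral\<^sup>L lborel ?g = complex_of_real (sqrt (2 * pi) * exp (- (t\<^sup>2 / 2)))"
    unfolding ge integral_mult_right_zero by (simp add: char_std_normal_distribution)
  have eq: "of_real (exp (- (a * s\<^sup>2))) * exp (- \<i> * of_real (b * s)) = ?g (0 + c * s)" for s
    using c by (simp add: t_def power_mult_distrib)
  show ?I
    unfolding eq using c by (intro lborel_integrable_real_affine[OF gi]) simp
  have "of_real c * (LINT s|lborel. ?g (0 + c * s)) = complex_of_real (sqrt (2 * pi) * exp (- (t\<^sup>2 / 2)))"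
    using lborel_integral_real_affine[of c ?g 0] c gL by (simp add: scaleR_conv_of_real)
  moreover have "sqrt (2 * pi) / c = sqrt (pi / a)"
    using assms by (simp add: c_def real_sqrt_divide[symmetric] del: real_sqrt_mult)
  moreover have "t\<^sup>2 / 2 = b\<^sup>2 / (4 * a)"
    using c by (simp add: t_def power_divide)
  ultimately show ?L
    unfolding eq using c by (simp add: field_simps)
qed

text \<open>Lebesgue measure is the image of the product of the one-dimensional measures over the
  basis, so integrals of products over coordinates factor.\<close>

lemma lborel_prod_Basis:
  fixes h :: "'a::euclidean_space \<Rightarrow> real \<Rightarrow> complex"
  assumes h: "\<And>b. b \<in> Basis \<Longrightarrow> integrable lborel (h b)"
  shows "integrable lborel (\<lambda>x::'a. \<Prod>b\<in>Basis. h b (x \<bullet> b))" (is ?I)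
    and "(LINT x|lborel. (\<Prod>b\<in>Basis. h b (x \<bullet> b))) = (\<Prod>b\<in>Basis. integral\<^sup>L lborel (h b))" (is ?L)
proof -
  interpret product_sigma_finite "\<lambda>_::'a. lborel :: real measure" ..
  have m: "h b \<in> borel_measurable borel" if "b \<in> Basis" for b
    using h[OF that] by auto
  have [measurable]: "(\<lambda>x::'a. \<Prod>b\<in>Basis. h b (x \<bullet> b)) \<in> borel_measurable borel"
    by (intro borel_measurable_prod measurable_compose[OF _ m]) auto
  have [measurable]: "(\<lambda>f. \<Sum>b\<in>Basis. f b *\<^sub>R b) \<in> (\<Pi>\<^sub>M b\<in>Basis. lborel) \<rightarrow>\<^sub>M (borel :: 'a measure)"
    by measurable
  have eq: "(\<Prod>b\<in>Basis. h b ((\<Sum>b\<in>Basis. f b *\<^sub>R b) \<bullet> b)) = (\<Prod>b\<in>Basis. h b (f b))" for f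
    by simp
  show ?I
    unfolding lborel_eq[where 'a='a]
    by (subst integrable_distr_eq) (auto simp: eq intro!: product_integrable_prod h)
  show ?L
    by (subst lborel_eq, subst integral_distr) (auto simp: eq intro!: product_integral_prod h)
qed

text \<open>Both the Gaussian and the character are products over coordinates, which reduces the
  claim to the real line.\<close>

lemma
  fixes x :: "'a::euclidean_space"
  assumes "0 < a"
  shows integrable_gaussian_fourier: "integrable lborel (\<lambda>t::'a. of_real (exp (- (a * (norm t)\<^sup>2))) * exp (- \<i> * of_real (x \<bullet> t)))" (is ?I)
    and LINT_gaussian_fourier: "(LINT t|lborel. of_real (exp (- (a * (norm t)\<^sup>2))) * exp (- \<i> * of_real (x \<bullet> t))) =
      complex_of_real ((pi / a) powr (real DIM('a) / 2) * exp (- ((norm x)\<^sup>2 / (4 * a))))" (is ?L)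
proof -
  let ?h = "\<lambda>b s. of_real (exp (- (a * s\<^sup>2))) * exp (- \<i> * complex_of_real ((x \<bullet> b) * s))"
  have n2: "(norm y)\<^sup>2 = (\<Sum>b\<in>Basis. (y \<bullet> b)\<^sup>2)" for y :: 'a
    by (subst power2_norm_eq_inner, subst euclidean_inner) (simp add: power2_eq_square)
  have eq: "of_real (exp (- (a * (norm t)\<^sup>2))) * exp (- \<i> * of_real (x \<bullet> t)) = (\<Prod>b\<in>Basis. ?h b (t \<bullet> b))" for t
    unfolding prod.distrib n2 euclidean_inner[of x t]
    by (simp add: sum_distrib_left exp_sum sum_negf[symmetric] exp_minus prod_inversef[symmetric])
  note h = LINT_gaussian_fourier_real_line[OF assms]
  show ?I
    unfolding eq by (intro lborel_prod_Basis h)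
  have "(LINT t|lborel. of_real (exp (- (a * (norm t)\<^sup>2))) * exp (- \<i> * of_real (x \<bullet> t))) =
      (\<Prod>b\<in>(Basis::'a set). complex_of_real (sqrt (pi / a) * exp (- ((x \<bullet> b)\<^sup>2 / (4 * a)))))"
    unfolding eq by (subst lborel_prod_Basis(2)[OF h(1)]) (simp only: h(2))
  also have "\<dots> = complex_of_real ((\<Prod>b\<in>(Basis::'a set). sqrt (pi / a)) * (\<Prod>b\<in>Basis. exp (- ((x \<bullet> b)\<^sup>2 / (4 * a)))))"
    by (simp only: prod.distrib of_real_prod of_real_mult)
  also have "(\<Prod>b\<in>Basis. exp (- ((x \<bullet> b)\<^sup>2 / (4 * a)))) = exp (- ((norm x)\<^sup>2 / (4 * a)))"
    by (simp add: exp_sum[symmetric] n2 sum_divide_distrib sum_negf)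
  also have "(\<Prod>b\<in>(Basis::'a set). sqrt (pi / a)) = (pi / a) powr (real DIM('a) / 2)"
    using assms by (simp add: powr_half_sqrt[symmetric] powr_powr flip: powr_realpow)
  finally show ?L .
qed

lemma
  assumes "0 < a"
  shows integrable_gaussian: "integrable lborel (\<lambda>t::'a::euclidean_space. exp (- (a * (norm t)\<^sup>2)))" (is ?I)
    and LINT_gaussian: "(LINT t::'a|lborel. exp (- (a * (norm t)\<^sup>2))) = (pi / a) powr (real DIM('a) / 2)" (is ?L)
proof -
  show ?I
    using integrable_gaussian_fourier[OF assms, of "0::'a"] by (simp only: inner_zero_left of_real_0 mult_zero_right exp_zero mult_1_right complex_of_real_integrable_eq)
  have "complex_of_real (LINT t::'a|lborel. exp (- (a * (norm t)\<^sup>2))) = of_real ((pi / a) powr (real DIM('a) / 2))"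
    using LINT_gaussian_fourier[OF assms, of "0::'a"] unfolding integral_complex_of_real[symmetric] by simp
  then show ?L by (simp only: of_real_eq_iff)
qed

section \<open>The heat kernel as an approximate identity, and Fourier inversion\<close>

lemma lborel_integral_affine:
  fixes h :: "'a::euclidean_space \<Rightarrow> real"
  assumes [measurable]: "h \<in> borel_measurable borel" and c: "0 < c"
  shows "(LINT y|lborel. h y) = c ^ DIM('a) * (LINT u|lborel. h (t + c *\<^sub>R u))"
  using c by (subst lborel_affine[of c t]) (simp_all add: integral_density integral_distr)

text \<open>Raise u \<le> exp u, at u = kq/m, to the power m. It lets an exponential absorb a
  negative power, both in the heat kernel and in the Riesz kernel.\<close>

lemma powr_mult_exp_le:
  fixes m k q :: real
  assumes "0 < m" "0 < k" "0 < q"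
  shows "q powr m * exp (- (k * q)) \<le> (m / k) powr m"
proof -
  have "k * q / m \<le> exp (k * q / m)"
    using exp_ge_add_one_self[of "k * q / m"] by linarith
  then have "(k * q / m) powr m \<le> exp (k * q / m) powr m"
    using assms by (intro powr_mono2) auto
  also have "\<dots> = exp (k * q)"
    using assms by (simp add: powr_def)
  finally show ?thesis
    using assms by (simp add: powr_divide powr_mult exp_minus field_simps)
qed

text \<open>The part of \<open>f\<close> near \<open>x\<close> is bounded, so there dominated convergence applies after rescaling;
  away from \<open>x\<close> the kernel tends to \<open>0\<close> uniformly.\<close>
lemma heat_kernel_tendsto:
  fixes f :: "'a::euclidean_space \<Rightarrow> real" and a :: "nat \<Rightarrow> real"
  assumes f: "integrable lborel f" and cont: "isCont f x"
    and a: "\<And>k. 0 < a k" "a \<longlonglongrightarrow> 0"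
  shows "(\<lambda>k. (pi / a k) powr (real DIM('a) / 2) * (LINT y|lborel. f y * exp (- ((norm (x - y))\<^sup>2 / (4 * a k)))))
    \<longlonglongrightarrow> (2 * pi) ^ DIM('a) * f x"
proof -
  define m where "m = real DIM('a) / 2"
  have m: "0 < m" by (simp add: m_def)
  have fm[measurable]: "f \<in> borel_measurable borel" using f by auto
  obtain d where d: "0 < d" "\<And>y. dist y x < d \<Longrightarrow> dist (f y) (f x) < 1"
    using cont unfolding continuous_at_eps_delta by (meson zero_less_one)
  define f1 where "f1 = (\<lambda>y. f y * indicator (ball x d) y)"
  define f2 where "f2 = (\<lambda>y. f y * indicator (- ball x d) y)"
  let ?K = "\<lambda>k y. exp (- ((norm (x - y))\<^sup>2 / (4 * a k)))"
  have [measurable]: "f1 \<in> borel_measurable borel" "f2 \<in> borel_measurable borel"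
    unfolding f1_def f2_def by (intro borel_measurable_times borel_measurable_indicator fm; simp)+
  have bd: "\<bar>f1 y\<bar> \<le> \<bar>f x\<bar> + 1" for y
    using d(2)[of y] by (auto simp: f1_def indicator_def dist_real_def dist_commute)
  have K1: "integrable lborel (\<lambda>y. f1 y * ?K k y)"
    and K2: "integrable lborel (\<lambda>y. f2 y * ?K k y)" and f2i: "integrable lborel f2" for k
    using a(1)[of k] by (auto intro!: Bochner_Integration.integrable_bound[OF f] AE_I2 mult_right_le_one_le simp: abs_mult f1_def f2_def indicator_def)
  have split: "(LINT y|lborel. f y * ?K k y) = (LINT y|lborel. f1 y * ?K k y) + (LINT y|lborel. f2 y * ?K k y)" for k
    by (subst Bochner_Integration.integral_add[symmetric, OF K1 K2])
       (auto intro!: Bochner_Integration.integral_cong simp: f1_def f2_def indicator_def)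
  \<comment> \<open>Substituting y = x + sqrt(a k) u produces the volume factor (a k)^m, which
    cancels the singular normalisation and leaves a Gaussian in u independent of k.\<close>
  have n1: "(pi / a k) powr m * (LINT y|lborel. f1 y * ?K k y) =
      pi powr m * (LINT u|lborel. f1 (x + sqrt (a k) *\<^sub>R u) * exp (- (1/4 * (norm u)\<^sup>2)))" for k
  proof -
    have Ku: "?K k (x + sqrt (a k) *\<^sub>R u) = exp (- (1/4 * (norm u)\<^sup>2))" for u
      using a(1)[of k] by (simp add: power_mult_distrib)
    have "(LINT y|lborel. f1 y * ?K k y) = sqrt (a k) ^ DIM('a) *
        (LINT u|lborel. f1 (x + sqrt (a k) *\<^sub>R u) * ?K k (x + sqrt (a k) *\<^sub>R u))"
      using a(1)[of k] by (intro lborel_integral_affine) auto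
    also have "sqrt (a k) ^ DIM('a) = a k powr m"
      using a(1)[of k] by (simp add: powr_half_sqrt[symmetric] powr_powr m_def flip: powr_realpow)
    finally show ?thesis
      unfolding Ku using a(1)[of k] by (simp add: powr_divide)
  qed
  have "(\<lambda>k. LINT u|lborel. f1 (x + sqrt (a k) *\<^sub>R u) * exp (- (1/4 * (norm u)\<^sup>2)))
      \<longlonglongrightarrow> (LINT u::'a|lborel. f x * exp (- (1/4 * (norm u)\<^sup>2)))"
  proof (rule integral_dominated_convergence)
    show "integrable lborel (\<lambda>u::'a. (\<bar>f x\<bar> + 1) * exp (- (1/4 * (norm u)\<^sup>2)))"
      by (intro integrable_mult_right integrable_gaussian) simp
    show "AE u in lborel. norm (f1 (x + sqrt (a k) *\<^sub>R u) * exp (- (1/4 * (norm u)\<^sup>2))) \<le> (\<bar>f x\<bar> + 1) * exp (- (1/4 * (norm u)\<^sup>2))" for k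
      using bd by (auto simp: abs_mult)
    show "AE u in lborel. (\<lambda>k. f1 (x + sqrt (a k) *\<^sub>R u) * exp (- (1/4 * (norm u)\<^sup>2))) \<longlonglongrightarrow> f x * exp (- (1/4 * (norm u)\<^sup>2))"
    proof (intro AE_I2 tendsto_mult tendsto_const)
      fix u :: 'a
      have "(\<lambda>k. x + sqrt (a k) *\<^sub>R u) \<longlonglongrightarrow> x + sqrt 0 *\<^sub>R u"
        by (intro tendsto_intros a)
      then have lim: "(\<lambda>k. x + sqrt (a k) *\<^sub>R u) \<longlonglongrightarrow> x" by simp
      have "\<forall>\<^sub>F k in sequentially. x + sqrt (a k) *\<^sub>R u \<in> ball x d"
        using topological_tendstoD[OF lim, of "ball x d"] d by simp
      then have "\<forall>\<^sub>F k in sequentially. f (x + sqrt (a k) *\<^sub>R u) = f1 (x + sqrt (a k) *\<^sub>R u)"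
        by eventually_elim (simp add: f1_def)
      with isCont_tendsto_compose[OF cont lim]
      show "(\<lambda>k. f1 (x + sqrt (a k) *\<^sub>R u)) \<longlonglongrightarrow> f x"
        by (rule Lim_transform_eventually)
    qed
  qed measurable
  then have "(\<lambda>k. pi powr m * (LINT u|lborel. f1 (x + sqrt (a k) *\<^sub>R u) * exp (- (1/4 * (norm u)\<^sup>2))))
      \<longlonglongrightarrow> pi powr m * (LINT u::'a|lborel. f x * exp (- (1/4 * (norm u)\<^sup>2)))"
    by (intro tendsto_intros)
  \<comment> \<open>The Gaussian integral contributes (4 pi)^m, so the constant is (4 pi^2)^m, the
    power of 2 pi with exponent 2m, the dimension.\<close>
  also have "pi powr m * (LINT u::'a|lborel. f x * exp (- (1/4 * (norm u)\<^sup>2))) = (pi * (pi * 4)) powr m * f x"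
    using LINT_gaussian[of "1/4", where 'a='a] by (simp add: powr_mult m_def)
  also have "(pi * (pi * 4)) powr m = (2 * pi) ^ DIM('a)"
  proof -
    have "(pi * (pi * 4)) powr m = ((2 * pi) * (2 * pi)) powr m" by (simp add: mult_ac)
    also have "\<dots> = (2 * pi) powr m * (2 * pi) powr m" by (rule powr_mult)
    also have "\<dots> = (2 * pi) powr real DIM('a)" by (simp add: m_def flip: powr_add)
    also have "\<dots> = (2 * pi) ^ DIM('a)" by (rule powr_realpow) simp
    finally show ?thesis .
  qed
  finally have lim1: "(\<lambda>k. (pi / a k) powr m * (LINT y|lborel. f1 y * ?K k y)) \<longlonglongrightarrow> (2 * pi) ^ DIM('a) * f x"
    unfolding n1 .
  \<comment> \<open>The bound \<open>powr_mult_exp_le\<close> is used with exponent m + 1 instead of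
    m: the additional power of 1 / a k makes the far part O(a k), not merely bounded.\<close>
  define B where "B = pi powr m * ((m + 1) / (d\<^sup>2 / 4)) powr (m + 1) * (LINT y|lborel. \<bar>f2 y\<bar>)"
  have "norm ((pi / a k) powr m * (LINT y|lborel. f2 y * ?K k y)) \<le> B * a k" for k
  proof -
    have "norm (LINT y|lborel. f2 y * ?K k y) \<le> (LINT y|lborel. norm (f2 y * ?K k y))"
      by (rule integral_norm_bound)
    also have "\<dots> \<le> (LINT y|lborel. \<bar>f2 y\<bar> * exp (- (d\<^sup>2 / 4 * (1 / a k))))"
    proof (intro integral_mono integrable_norm K2 integrable_mult_left integrable_abs f2i)
      fix y
      show "norm (f2 y * ?K k y) \<le> \<bar>f2 y\<bar> * exp (- (d\<^sup>2 / 4 * (1 / a k)))"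
      proof (cases "y \<in> ball x d")
        case False
        then have "d\<^sup>2 \<le> (norm (x - y))\<^sup>2"
          using d by (intro power_mono) (auto simp: dist_norm)
        then show ?thesis
          using a(1)[of k] by (auto simp: abs_mult divide_simps intro!: mult_left_mono)
      qed (simp add: f2_def)
    qed
    finally have 1: "norm (LINT y|lborel. f2 y * ?K k y) \<le> (LINT y|lborel. \<bar>f2 y\<bar>) * exp (- (d\<^sup>2 / 4 * (1 / a k)))"
      by simp
    have "(1 / a k) powr (m + 1) * exp (- (d\<^sup>2 / 4 * (1 / a k))) \<le> ((m + 1) / (d\<^sup>2 / 4)) powr (m + 1)"
      using m d a(1)[of k] by (intro powr_mult_exp_le) auto
    then have 2: "(1 / a k) powr m * exp (- (d\<^sup>2 / 4 * (1 / a k))) \<le> ((m + 1) / (d\<^sup>2 / 4)) powr (m + 1) * a k"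
      using a(1)[of k] by (simp add: powr_add field_simps)
    have "norm ((pi / a k) powr m * (LINT y|lborel. f2 y * ?K k y)) = (pi / a k) powr m * norm (LINT y|lborel. f2 y * ?K k y)"
      by (simp add: abs_mult)
    also have "\<dots> \<le> (pi / a k) powr m * ((LINT y|lborel. \<bar>f2 y\<bar>) * exp (- (d\<^sup>2 / 4 * (1 / a k))))"
      by (intro mult_left_mono 1) simp
    also have "\<dots> = pi powr m * (LINT y|lborel. \<bar>f2 y\<bar>) * ((1 / a k) powr m * exp (- (d\<^sup>2 / 4 * (1 / a k))))"
      using a(1)[of k] by (simp add: powr_divide)
    also have "\<dots> \<le> pi powr m * (LINT y|lborel. \<bar>f2 y\<bar>) * (((m + 1) / (d\<^sup>2 / 4)) powr (m + 1) * a k)"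
      by (intro mult_left_mono 2) auto
    finally show ?thesis by (simp add: B_def mult_ac)
  qed
  then have "(\<lambda>k. (pi / a k) powr m * (LINT y|lborel. f2 y * ?K k y)) \<longlonglongrightarrow> 0"
    by (intro Lim_null_comparison[OF always_eventually tendsto_mult_right_zero[OF a(2)]] allI)
  from tendsto_add[OF lim1 this] show ?thesis
    unfolding split m_def by (simp add: distrib_left)
qed

text \<open>Gaussian regularisation makes the inversion integral converge although \<open>F\<close> need not be integrable.\<close>
lemma gaussian_fourier_inversion:
  fixes f :: "'a::euclidean_space \<Rightarrow> real" and a :: "nat \<Rightarrow> real"
  assumes f: "integrable lborel f" and cont: "isCont f x"
    and F: "\<And>t. (LINT y|lborel. exp (\<i> * complex_of_real (y \<bullet> t)) * complex_of_real (f y)) = F t"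
    and a: "\<And>k. 0 < a k" "a \<longlonglongrightarrow> 0"
  shows "(\<lambda>k. LINT t|lborel. F t * (of_real (exp (- (a k * (norm t)\<^sup>2))) * exp (- \<i> * of_real (x \<bullet> t))))
    \<longlonglongrightarrow> complex_of_real ((2 * pi) ^ DIM('a) * f x)"
proof -
  have fm[measurable]: "f \<in> borel_measurable borel" using f by auto
  have "(LINT t|lborel. F t * (of_real (exp (- (a k * (norm t)\<^sup>2))) * exp (- \<i> * of_real (x \<bullet> t)))) =
    complex_of_real ((pi / a k) powr (real DIM('a) / 2) * (LINT y|lborel. f y * exp (- ((norm (x - y))\<^sup>2 / (4 * a k)))))" for k
  proof -
    \<comment> \<open>Integrating over y first gives the damped inversion integral of
      \<open>F\<close>; integrating over t first gives the heat kernel at x - y.\<close>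
    define h where "h = (\<lambda>t y. exp (\<i> * complex_of_real (y \<bullet> t)) * complex_of_real (f y) *
      (of_real (exp (- (a k * (norm t)\<^sup>2))) * exp (- \<i> * of_real (x \<bullet> t))))"
    define g where "g = (\<lambda>(t::'a) y. \<bar>f y\<bar> * exp (- (a k * (norm t)\<^sup>2)))"
    have m: "(\<lambda>(x, y). h x y) \<in> borel_measurable (lborel \<Otimes>\<^sub>M lborel)"
      unfolding h_def by measurable
    have hg: "norm (h t y) \<le> g t y" for t y
      by (simp add: h_def g_def norm_mult)
    have gi: "integrable lborel (g t)" for t
      unfolding g_def using f by (intro integrable_mult_left integrable_abs)
    have gL: "(LINT y|lborel. g t y) = (LINT y|lborel. \<bar>f y\<bar>) * exp (- (a k * (norm t)\<^sup>2))" for t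
      unfolding g_def by simp
    have gG: "integrable lborel (\<lambda>t. LINT y|lborel. g t y)"
      unfolding gL using a by (intro integrable_mult_right integrable_gaussian)
    have hy: "(LINT y|lborel. h t y) = F t * (of_real (exp (- (a k * (norm t)\<^sup>2))) * exp (- \<i> * of_real (x \<bullet> t)))" for t
      unfolding h_def integral_mult_left_zero F ..
    have "h t y = of_real (f y) * (of_real (exp (- (a k * (norm t)\<^sup>2))) * exp (- \<i> * of_real ((x - y) \<bullet> t)))" for t y
      by (simp add: h_def inner_diff_left algebra_simps exp_diff exp_minus divide_simps)
    then have ht: "(LINT t|lborel. h t y) = of_real (f y) * complex_of_real ((pi / a k) powr (real DIM('a) / 2) * exp (- ((norm (x - y))\<^sup>2 / (4 * a k))))" for y
      using LINT_gaussian_fourier[OF a(1), of k "x - y"] by (simp only: integral_mult_right_zero)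
    have ht: "(LINT t|lborel. h t y) = complex_of_real ((pi / a k) powr (real DIM('a) / 2) * (f y * exp (- ((norm (x - y))\<^sup>2 / (4 * a k)))))" for y
      unfolding ht by simp
    show ?thesis
      using lborel_Fubini(2)[OF m hg gi gG] unfolding hy ht integral_complex_of_real integral_mult_right_zero .
  qed
  then show ?thesis
    using heat_kernel_tendsto[OF f cont a] by (simp only: tendsto_of_real_iff)
qed

section \<open>The Mellin--Barnes integral\<close>

lemma measurable_Gamma_halfplane:
  fixes f :: "real \<Rightarrow> complex"
  assumes "continuous_on UNIV f" "\<And>y. 0 < Re (f y)"
  shows "(\<lambda>y. Gamma (f y)) \<in> borel_measurable borel"
proof (intro borel_measurable_continuous_onI continuous_on_compose2[OF continuous_on_Gamma assms(1)])
  show "{z. 0 < Re z} \<inter> \<int>\<^sub>\<le>\<^sub>0 = {}"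
    by (auto elim!: nonpos_Ints_cases)
qed (use assms(2) in auto)

text \<open>Comparison with the Beta kernel exp(kx) (1 + exp x)^(-2k), both of whose tails decay at
  rate k. The constant 2^(2k) comes from 1 + exp x \<le> 2 exp(max 0 x).\<close>

lemma integrable_exp_abs:
  fixes k :: real
  assumes "0 < k"
  shows "integrable lborel (\<lambda>x. exp (- (k * \<bar>x\<bar>)))"
proof (rule Bochner_Integration.integrable_bound)
  show "integrable lborel (\<lambda>x. exp (2 * k * ln 2) * exp (k * x - (2 * k) * ln (1 + exp x)))"
    using assms by (intro integrable_mult_right integrable_Beta_kernel_real) auto
  show "AE x in lborel. norm (exp (- (k * \<bar>x\<bar>))) \<le> norm (exp (2 * k * ln 2) * exp (k * x - (2 * k) * ln (1 + exp x)))"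
  proof (rule AE_I2)
    fix x :: real
    have "1 + exp x \<le> 2 * exp (max 0 x)"
      by (cases "0 \<le> x") (auto simp: max_def)
    then have "ln (1 + exp x) \<le> ln (2 * exp (max 0 x))"
      by (subst ln_le_cancel_iff) (auto simp: add_pos_pos)
    also have "\<dots> = ln 2 + max 0 x"
      by (subst ln_mult) auto
    finally have "k * ln (1 + exp x) \<le> k * (ln 2 + max 0 x)"
      using assms by (intro mult_left_mono) auto
    moreover have "k * max 0 x = (k * x + k * \<bar>x\<bar>) / 2"
      by (auto simp: max_def abs_if)
    ultimately have "- (k * \<bar>x\<bar>) \<le> 2 * k * ln 2 + (k * x - (2 * k) * ln (1 + exp x))"
      unfolding distrib_left mult.assoc by linarith
    then show "norm (exp (- (k * \<bar>x\<bar>))) \<le> norm (exp (2 * k * ln 2) * exp (k * x - (2 * k) * ln (1 + exp x)))"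
      by (simp flip: exp_add)
  qed
qed measurable

context
  fixes c \<nu> \<beta> :: real
  assumes c: "0 < c" "c < \<nu>" and \<beta>: "0 < \<beta>" "\<beta> < 1"
begin

lemma measurable_Gamma_factors [measurable]:
  "(\<lambda>y. Gamma (Complex c y)) \<in> borel_measurable borel"
  "(\<lambda>y. Gamma (of_real \<nu> - Complex c y)) \<in> borel_measurable borel"
  "(\<lambda>y. Gamma (of_real \<beta> * Complex c y)) \<in> borel_measurable borel"
  using c \<beta> by (auto simp: Complex_eq intro!: measurable_Gamma_halfplane continuous_intros)

lemma norm_Gamma_Gamma_le:
  assumes "0 < e"
  obtains C where "0 < C"
    "\<And>y. norm (Gamma (Complex c y) * Gamma (of_real \<nu> - Complex c y)) \<le> C * exp ((2 * e - pi) * \<bar>y\<bar>)"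
proof -
  obtain C where C: "0 < C" "\<And>s. norm (Gamma (Complex c s)) \<le> C * exp ((e - pi / 2) * \<bar>s\<bar>)"
    using norm_Gamma_vertical_le c(1) assms by blast
  obtain D where D: "0 < D" "\<And>s. norm (Gamma (Complex (\<nu> - c) s)) \<le> D * exp ((e - pi / 2) * \<bar>s\<bar>)"
    using norm_Gamma_vertical_le[of "\<nu> - c" e] c(2) assms by auto
  have eq: "of_real \<nu> - Complex c y = Complex (\<nu> - c) (- y)" for y
    by (simp add: complex_eq_iff)
  have "norm (Gamma (Complex c y) * Gamma (of_real \<nu> - Complex c y)) \<le>
      (C * exp ((e - pi / 2) * \<bar>y\<bar>)) * (D * exp ((e - pi / 2) * \<bar>y\<bar>))" for y
    unfolding norm_mult eq using C(2)[of y] D(2)[of "- y"] C(1) by (intro mult_mono) auto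
  also have "(C * exp ((e - pi / 2) * \<bar>y\<bar>)) * (D * exp ((e - pi / 2) * \<bar>y\<bar>)) =
      C * D * exp ((2 * e - pi) * \<bar>y\<bar>)" for y
    by (simp add: algebra_simps flip: exp_add)
  finally show thesis using that[of "C * D"] C(1) D(1) by simp
qed

lemma integrable_Gamma_Gamma:
  "integrable lborel (\<lambda>y. Gamma (Complex c y) * Gamma (of_real \<nu> - Complex c y))"
proof -
  obtain C where C: "0 < C"
    "\<And>y. norm (Gamma (Complex c y) * Gamma (of_real \<nu> - Complex c y)) \<le> C * exp ((2 * (pi / 4) - pi) * \<bar>y\<bar>)"
    using norm_Gamma_Gamma_le[of "pi / 4"] by auto
  show ?thesis
  proof (rule Bochner_Integration.integrable_bound)
    show "integrable lborel (\<lambda>y. C * exp (- (pi / 2 * \<bar>y\<bar>)))"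
      by (intro integrable_mult_right integrable_exp_abs) simp
    show "AE y in lborel. norm (Gamma (Complex c y) * Gamma (of_real \<nu> - Complex c y)) \<le> norm (C * exp (- (pi / 2 * \<bar>y\<bar>)))"
      using C by (auto simp: field_simps abs_mult)
  qed measurable
qed

text \<open>The numerator decays at nearly rate pi, while the reciprocal Gamma grows at most at
  nearly rate pi/2, since \<beta> < 1. The slack pi/12 enters three times in all and leaves decay at
  rate pi/4.\<close>

lemma integrable_Gamma_Gamma_divide:
  "integrable lborel (\<lambda>y. Gamma (Complex c y) * Gamma (of_real \<nu> - Complex c y) / Gamma (of_real \<beta> * Complex c y))"
proof -
  obtain C where C: "0 < C"
    "\<And>y. norm (Gamma (Complex c y) * Gamma (of_real \<nu> - Complex c y)) \<le> C * exp ((2 * (pi / 12) - pi) * \<bar>y\<bar>)"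
    using norm_Gamma_Gamma_le[of "pi / 12"] by auto
  obtain D where D: "0 < D" "\<And>s. norm (inverse (Gamma (Complex (\<beta> * c) s))) \<le> D * exp ((pi / 12 + pi / 2) * \<bar>s\<bar>)"
    using norm_inverse_Gamma_vertical_le[of "\<beta> * c" "pi / 12"] c \<beta> by auto
  show ?thesis
  proof (rule Bochner_Integration.integrable_bound)
    show "integrable lborel (\<lambda>y. C * D * exp (- (pi / 4 * \<bar>y\<bar>)))"
      by (intro integrable_mult_right integrable_exp_abs) simp
    show "AE y in lborel. norm (Gamma (Complex c y) * Gamma (of_real \<nu> - Complex c y) / Gamma (of_real \<beta> * Complex c y))
        \<le> norm (C * D * exp (- (pi / 4 * \<bar>y\<bar>)))"
    proof (rule AE_I2)
      fix y
      have eq: "of_real \<beta> * Complex c y = Complex (\<beta> * c) (\<beta> * y)"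
        by (simp add: complex_eq_iff)
      have "norm (Gamma (Complex c y) * Gamma (of_real \<nu> - Complex c y) / Gamma (of_real \<beta> * Complex c y)) =
          norm (Gamma (Complex c y) * Gamma (of_real \<nu> - Complex c y)) * norm (inverse (Gamma (Complex (\<beta> * c) (\<beta> * y))))"
        unfolding eq by (simp add: norm_mult norm_divide norm_inverse divide_inverse)
      also have "\<dots> \<le> (C * exp ((2 * (pi / 12) - pi) * \<bar>y\<bar>)) * (D * exp ((pi / 12 + pi / 2) * \<bar>\<beta> * y\<bar>))"
        using C D by (intro mult_mono) auto
      also have "\<dots> = C * D * exp ((2 * (pi / 12) - pi) * \<bar>y\<bar> + (pi / 12 + pi / 2) * \<bar>\<beta> * y\<bar>)"
        by (simp only: exp_add mult_ac)
      also have "(2 * (pi / 12) - pi) * \<bar>y\<bar> + (pi / 12 + pi / 2) * \<bar>\<beta> * y\<bar> \<le> - (pi / 4 * \<bar>y\<bar>)"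
      proof -
        have "\<bar>\<beta> * y\<bar> \<le> \<bar>y\<bar>"
          using \<beta> by (simp add: abs_mult mult_left_le_one_le)
        then have "(pi / 12 + pi / 2) * \<bar>\<beta> * y\<bar> \<le> (pi / 12 + pi / 2) * \<bar>y\<bar>"
          by (intro mult_left_mono) auto
        then show ?thesis by (simp add: algebra_simps)
      qed
      finally show "norm (Gamma (Complex c y) * Gamma (of_real \<nu> - Complex c y) / Gamma (of_real \<beta> * Complex c y))
          \<le> norm (C * D * exp (- (pi / 4 * \<bar>y\<bar>)))"
        using C(1) D(1) by (simp add: abs_mult)
    qed
  qed measurable
qed

text \<open>Fourier inversion at the point v of the Beta kernel, whose transform along the line Re w
  = c is Gamma(w) Gamma(\<nu>-w) / Gamma(\<nu>). With u = exp v it expresses (1+u)^(-\<nu>) as a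
  superposition of the powers u^(-w).\<close>

lemma Mellin_Barnes_binomial:
  "(LINT y|lborel. Gamma (Complex c y) * Gamma (of_real \<nu> - Complex c y) * exp (- Complex c y * of_real v)) =
    complex_of_real (2 * pi * Gamma \<nu> * (1 + exp v) powr (- \<nu>))"
proof -
  define h where "h = (\<lambda>x. exp (c * x - \<nu> * ln (1 + exp x)))"
  define G where "G = (\<lambda>y. Gamma (Complex c y) * Gamma (of_real \<nu> - Complex c y))"
  define a where "a = (\<lambda>k. inverse (real (Suc k)))"
  have a: "\<And>k. 0 < a k" "a \<longlonglongrightarrow> 0"
    unfolding a_def using LIMSEQ_inverse_real_of_nat by auto
  have hi: "integrable lborel h"
    unfolding h_def using c by (rule integrable_Beta_kernel_real)
  have hc: "isCont h v"
    unfolding h_def by (intro continuous_intros) (simp add: add_pos_pos less_imp_neq[symmetric])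
  have pos: "0 < Gamma \<nu>" using c by (intro Gamma_real_pos) auto
  have hF: "(LINT x|lborel. exp (\<i> * complex_of_real (x \<bullet> y)) * complex_of_real (h x)) = G y / of_real (Gamma \<nu>)" for y
  proof -
    have "exp (\<i> * complex_of_real (x \<bullet> y)) * complex_of_real (h x) =
        exp (Complex c y * of_real x - of_real \<nu> * of_real (ln (1 + exp x)))" for x
      by (simp add: h_def Complex_eq exp_add[symmetric] algebra_simps flip: exp_of_real)
    then show ?thesis
      using LINT_Beta_kernel[of "Complex c y" "of_real \<nu>"] c by (simp add: G_def Gamma_complex_of_real)
  qed
  have Gi: "integrable lborel G"
    unfolding G_def by (rule integrable_Gamma_Gamma)
  have [measurable]: "G \<in> borel_measurable borel" using Gi by auto
  have "(\<lambda>k. LINT y|lborel. G y / of_real (Gamma \<nu>) * (of_real (exp (- (a k * (norm y)\<^sup>2))) * exp (- \<i> * of_real (v \<bullet> y))))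
      \<longlonglongrightarrow> complex_of_real ((2 * pi) ^ DIM(real) * h v)"
    by (rule gaussian_fourier_inversion[OF hi hc hF a])
  \<comment> \<open>Since \<open>G\<close> is integrable, the Gaussian damping may be removed; the
    limit is the same integrand with 0 in place of \<open>a k\<close>.\<close>
  moreover have "(\<lambda>k. LINT y|lborel. G y / of_real (Gamma \<nu>) * (of_real (exp (- (a k * (norm y)\<^sup>2))) * exp (- \<i> * of_real (v \<bullet> y))))
      \<longlonglongrightarrow> (LINT y|lborel. G y / of_real (Gamma \<nu>) * (of_real (exp (- (0 * (norm y)\<^sup>2))) * exp (- \<i> * of_real (v \<bullet> y))))"
  proof (rule integral_dominated_convergence)
    show "integrable lborel (\<lambda>y. norm (G y / of_real (Gamma \<nu>)))"
      using Gi by auto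
    show "AE y in lborel. norm (G y / of_real (Gamma \<nu>) * (of_real (exp (- (a k * (norm y)\<^sup>2))) * exp (- \<i> * of_real (v \<bullet> y))))
        \<le> norm (G y / of_real (Gamma \<nu>))" for k
      unfolding norm_mult[of "G _ / _"] using a(1)[of k] by (intro AE_I2 mult_right_le_one_le) (auto simp: norm_mult)
    show "AE y in lborel. (\<lambda>k. G y / of_real (Gamma \<nu>) * (of_real (exp (- (a k * (norm y)\<^sup>2))) * exp (- \<i> * of_real (v \<bullet> y))))
        \<longlonglongrightarrow> G y / of_real (Gamma \<nu>) * (of_real (exp (- (0 * (norm y)\<^sup>2))) * exp (- \<i> * of_real (v \<bullet> y)))"
      by (intro AE_I2 tendsto_intros a)
  qed measurable
  ultimately have "(LINT y|lborel. G y / of_real (Gamma \<nu>) * (of_real (exp (- (0 * (norm y)\<^sup>2))) * exp (- \<i> * of_real (v \<bullet> y)))) =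
      complex_of_real ((2 * pi) ^ DIM(real) * h v)"
    by (rule LIMSEQ_unique[symmetric])
  \<comment> \<open>The factor exp(-c v) restores the real part of the exponent -w v; it then
    cancels the exp(c v) contained in \<open>h v\<close>.\<close>
  moreover have "G y * exp (- Complex c y * of_real v) = of_real (Gamma \<nu> * exp (- c * v)) *
      (G y / of_real (Gamma \<nu>) * (of_real (exp (- (0 * (norm y)\<^sup>2))) * exp (- \<i> * of_real (v \<bullet> y))))" for y
    using pos by (simp add: Complex_eq exp_add[symmetric] algebra_simps flip: exp_of_real)
  ultimately have "(LINT y|lborel. G y * exp (- Complex c y * of_real v)) =
      of_real (Gamma \<nu> * exp (- c * v)) * of_real ((2 * pi) ^ DIM(real) * h v)"
    by (simp only: integral_mult_right_zero)
  also have "\<dots> = of_real (2 * pi * Gamma \<nu> * (exp (- c * v) * h v))"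
    by simp
  also have "exp (- c * v) * h v = (1 + exp v) powr (- \<nu>)"
    by (simp add: h_def powr_def add_pos_pos less_imp_neq[symmetric] flip: exp_add)
  finally show ?thesis unfolding G_def .
qed

end

section \<open>Regularised Riesz kernels\<close>

text \<open>
  From \<open>\<Gamma>(z) exp (- z ln |t|\<^sup>2) = \<integral> exp (z s - |t|\<^sup>2 exp s) ds\<close>: the integral over \<open>s\<close> of this kernel is \<open>\<Gamma>(z)\<close>
  times the Fourier transform of \<open>exp (- z ln |t|\<^sup>2 - a |t|\<^sup>2)\<close> at radius \<open>r\<close>, with \<open>m\<close> half the dimension.
\<close>
definition riesz_kernel :: "real \<Rightarrow> real \<Rightarrow> complex \<Rightarrow> real \<Rightarrow> real \<Rightarrow> complex" where
  "riesz_kernel m r z a s =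
     exp (z * of_real s) * of_real ((pi / (exp s + a)) powr m * exp (- (r\<^sup>2 / (4 * (exp s + a)))))"

text \<open>Exchange of the s and t integrals. For fixed s the integral over t is a Gaussian one
  with parameter exp s + a. Integrability of the majorant in s uses Re z > 0 at minus infinity,
  where a > 0 keeps the Gaussian integral bounded, and Re z < m at plus infinity.\<close>

lemma regularised_riesz:
  fixes x :: "'a::euclidean_space"
  assumes z: "0 < Re z" "Re z < real DIM('a) / 2" and a: "0 < a"
  defines "J \<equiv> (\<lambda>t::'a. exp (- z * of_real (ln ((norm t)\<^sup>2))) *
      (of_real (exp (- (a * (norm t)\<^sup>2))) * exp (- \<i> * of_real (x \<bullet> t))))"
  shows integrable_regularised_riesz: "integrable lborel J" (is ?I)
    and LINT_regularised_riesz: "integral\<^sup>L lborel J =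
      (LINT s|lborel. riesz_kernel (real DIM('a) / 2) (norm x) z a s) / Gamma z" (is ?L)
proof -
  define m where "m = real DIM('a) / 2"
  define E where "E = (\<lambda>t::'a. of_real (exp (- (a * (norm t)\<^sup>2))) * exp (- \<i> * complex_of_real (x \<bullet> t)))"
  define f where "f = (\<lambda>s t. exp (z * of_real s - of_real ((norm t)\<^sup>2 * exp s)) * E t)"
  define g where "g = (\<lambda>s (t::'a). exp (Re z * s) * exp (- ((exp s + a) * (norm t)\<^sup>2)))"
  have pos: "0 < exp s + a" for s :: real using a by (simp add: add_pos_pos)
  have mf: "(\<lambda>(s, t). f s t) \<in> borel_measurable (lborel \<Otimes>\<^sub>M lborel)"
    unfolding f_def E_def by measurable
  have fg: "norm (f s t) \<le> g s t" for s t
    by (simp add: f_def g_def E_def norm_mult exp_add[symmetric] algebra_simps)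
  have gi: "integrable lborel (g s)" for s
    unfolding g_def using pos by (intro integrable_mult_right integrable_gaussian)
  have gL: "(LINT t|lborel. g s t) = exp (Re z * s) * (pi / (exp s + a)) powr m" for s
    unfolding g_def integral_mult_right_zero using LINT_gaussian[OF pos] by (simp add: m_def)
  have gG: "integrable lborel (\<lambda>s. LINT t|lborel. g s t)"
    unfolding gL
  proof (rule Bochner_Integration.integrable_bound)
    \<comment> \<open>Chosen so that M (1 + exp s) \<le> exp s + a, which gives a multiple of the
      Beta kernel as majorant.\<close>
    define M where "M = min 1 a"
    have M: "0 < M" "M \<le> 1" "M \<le> a" using a by (auto simp: M_def)
    show "integrable lborel (\<lambda>s. (pi / M) powr m * exp (Re z * s - m * ln (1 + exp s)))"
      using z by (intro integrable_mult_right integrable_Beta_kernel_real) (auto simp: m_def)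
    show "AE s in lborel. norm (exp (Re z * s) * (pi / (exp s + a)) powr m) \<le>
        norm ((pi / M) powr m * exp (Re z * s - m * ln (1 + exp s)))"
    proof (rule AE_I2)
      fix s :: real
      have "M * exp s \<le> 1 * exp s" using M by (intro mult_right_mono) auto
      then have "M * (1 + exp s) \<le> exp s + a" using M unfolding distrib_left by linarith
      then have "(pi / (exp s + a)) powr m \<le> (pi / (M * (1 + exp s))) powr m"
        using M pos[of s] by (intro powr_mono2 divide_left_mono) (auto simp: m_def add_pos_pos)
      also have "\<dots> = (pi / M) powr m * exp (- (m * ln (1 + exp s)))"
        using M by (simp add: powr_divide powr_mult powr_def[of "1 + exp s"] exp_minus add_pos_pos less_imp_neq[symmetric] divide_simps)
      finally have "(pi / (exp s + a)) powr m \<le> (pi / M) powr m * exp (- (m * ln (1 + exp s)))" .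
      then have "exp (Re z * s) * (pi / (exp s + a)) powr m \<le> exp (Re z * s) * ((pi / M) powr m * exp (- (m * ln (1 + exp s))))"
        by (intro mult_left_mono) auto
      also have "\<dots> = (pi / M) powr m * exp (Re z * s - m * ln (1 + exp s))"
        by (simp add: exp_diff exp_minus field_simps)
      finally show "norm (exp (Re z * s) * (pi / (exp s + a)) powr m) \<le>
          norm ((pi / M) powr m * exp (Re z * s - m * ln (1 + exp s)))"
        by (simp add: abs_mult)
    qed
  qed measurable
  have ft: "(LINT t|lborel. f s t) = riesz_kernel m (norm x) z a s" for s
  proof -
    have "f s t = exp (z * of_real s) * (of_real (exp (- ((exp s + a) * (norm t)\<^sup>2))) * exp (- \<i> * of_real (x \<bullet> t)))" for t
      by (simp add: f_def E_def exp_add[symmetric] exp_diff exp_minus distrib_right mult_ac add_ac divide_simps flip: exp_of_real)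
    then show ?thesis
      using LINT_gaussian_fourier[OF pos, of s x] by (simp only: integral_mult_right_zero riesz_kernel_def m_def)
  qed
  \<comment> \<open>The origin is excluded because the Gamma integral in s requires |t|^2 >
    0.\<close>
  have fs: "AE t in lborel. (LINT s|lborel. f s t) = Gamma z * J t"
    using AE_lborel_singleton[of 0]
  proof eventually_elim
    case (elim t)
    show ?case
      unfolding f_def integral_mult_left_zero using elim z(1)
      by (subst LINT_exp_minus_scaled_exp) (auto simp: J_def E_def)
  qed
  have P: "integrable (lborel \<Otimes>\<^sub>M lborel) (\<lambda>(s, t). f s t)"
    by (rule lborel_Fubini(1)[OF mf fg gi gG])
  have i: "integrable lborel (\<lambda>t. LINT s|lborel. f s t)"
    by (rule lborel_pair.integrable_snd[OF P])
  have [measurable]: "J \<in> borel_measurable borel"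
    unfolding J_def by measurable
  have nz: "Gamma z \<noteq> 0" using z by (intro Gamma_neq_0)
  have "integrable lborel (\<lambda>t. Gamma z * J t)"
    using integrable_cong_AE[OF _ _ fs] i by auto
  then have "integrable lborel (\<lambda>t. 1 / Gamma z * (Gamma z * J t))"
    by (rule integrable_mult_right)
  then show ?I
    using nz by simp
  have "(LINT t|lborel. LINT s|lborel. f s t) = (LINT t|lborel. Gamma z * J t)"
    using i by (intro integral_cong_AE fs) auto
  then have "Gamma z * integral\<^sup>L lborel J = (LINT s|lborel. riesz_kernel m (norm x) z a s)"
    using lborel_Fubini(2)[OF mf fg gi gG] unfolding ft by simp
  then show ?L
    using nz by (simp add: m_def field_simps)
qed

text \<open>A majorant uniform down to a = 0. For r > 0 the factor exp(-r^2 / (4q)), with q = exp s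
  + a, compensates the blow-up of q^(-m) as q tends to 0: (1 + 1/q)^m exp(-k/q) is bounded. What
  remains is (1+q)^(-m) \<le> (1 + exp s)^(-m).\<close>

lemma norm_riesz_kernel_le:
  assumes "0 < m" "0 < r"
  obtains D where "0 < D"
    "\<And>z a s. 0 \<le> a \<Longrightarrow> norm (riesz_kernel m r z a s) \<le> D * exp (Re z * s - m * ln (1 + exp s))"
proof -
  define k where "k = r\<^sup>2 / 4"
  \<comment> \<open>\<open>exp k\<close> pays for replacing 1/q by 1 + 1/q in the exponent, so that
    \<open>powr_mult_exp_le\<close> applies at 1 + 1/q.\<close>
  define D where "D = pi powr m * (exp k * (m / k) powr m)"
  have k: "0 < k" using assms by (simp add: k_def)
  have "norm (riesz_kernel m r z a s) \<le> D * exp (Re z * s - m * ln (1 + exp s))" if a: "0 \<le> a" for z a s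
  proof -
    define q where "q = exp s + a"
    have q: "0 < q" "exp s \<le> q" using a by (simp_all add: q_def add_pos_nonneg)
    have p1: "0 < 1 + exp s" by (simp add: add_pos_pos)
    have "(1 + 1 / q) powr m * exp (- (k * (1 + 1 / q))) \<le> (m / k) powr m"
      using q k assms by (intro powr_mult_exp_le) (auto simp: add_pos_pos)
    then have "exp k * ((1 + 1 / q) powr m * exp (- (k * (1 + 1 / q)))) \<le> exp k * (m / k) powr m"
      by (intro mult_left_mono) auto
    moreover have "exp k * ((1 + 1 / q) powr m * exp (- (k * (1 + 1 / q)))) = (1 + 1 / q) powr m * exp (- (k / q))"
      by (simp add: exp_add[symmetric] distrib_left exp_minus mult_ac exp_add)
    moreover have "1 + 1 / q = (1 + q) / q" using q by (simp add: field_simps)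
    ultimately have 1: "((1 + q) / q) powr m * exp (- (k / q)) \<le> exp k * (m / k) powr m" by metis
    have "(1 + exp s) powr m * ((pi / q) powr m * exp (- (k / q))) \<le> (1 + q) powr m * ((pi / q) powr m * exp (- (k / q)))"
      using q assms p1 by (intro mult_right_mono powr_mono2) auto
    also have "\<dots> = pi powr m * (((1 + q) / q) powr m * exp (- (k / q)))"
      using q by (simp add: powr_divide)
    also have "\<dots> \<le> D"
      unfolding D_def by (intro mult_left_mono 1) auto
    finally have "(1 + exp s) powr m * ((pi / q) powr m * exp (- (k / q))) \<le> D" .
    then have 2: "(pi / q) powr m * exp (- (k / q)) \<le> D * exp (- (m * ln (1 + exp s)))"
      using p1 by (simp add: powr_def[of "1 + exp s"] exp_minus field_simps)
    have "norm (riesz_kernel m r z a s) = exp (Re z * s) * ((pi / q) powr m * exp (- (k / q)))"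
      using q by (simp add: riesz_kernel_def norm_mult q_def k_def mult_ac)
    also have "\<dots> \<le> exp (Re z * s) * (D * exp (- (m * ln (1 + exp s))))"
      by (intro mult_left_mono 2) auto
    finally show ?thesis by (simp add: exp_diff exp_minus field_simps)
  qed
  moreover have "0 < D" using k assms by (simp add: D_def)
  ultimately show thesis using that by blast
qed

text \<open>Reflecting s turns the integrand into that of a Gamma integral with parameter m - z and
  scale (r/2)^2. Divided by Gamma(z), the result is the classical Riesz kernel, the Fourier integral
  of |t|^(-2z) without damping.\<close>

lemma LINT_riesz_kernel_0:
  assumes "0 < r" "Re z < m"
  shows "(LINT s|lborel. riesz_kernel m r z 0 s) =
    of_real (pi powr m) * Gamma (of_real m - z) * exp ((z - of_real m) * of_real (2 * ln (r / 2)))"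
proof -
  define k where "k = (r / 2)\<^sup>2"
  have k: "0 < k" using assms by (simp add: k_def)
  have eq: "riesz_kernel m r z 0 (0 + (-1) * s) =
      of_real (pi powr m) * exp ((of_real m - z) * of_real s - of_real (k * exp s))" for s
  proof -
    have "(pi / exp (- s)) powr m = pi powr m * exp (m * s)"
      by (simp add: exp_minus field_simps powr_mult powr_def[of "exp s"])
    moreover have "r\<^sup>2 / (4 * exp (- s)) = k * exp s"
      by (simp add: k_def power_divide exp_minus field_simps)
    ultimately show ?thesis
      by (simp add: riesz_kernel_def exp_add[symmetric] algebra_simps flip: exp_of_real)
  qed
  have "(LINT s|lborel. riesz_kernel m r z 0 s) = (LINT s|lborel. riesz_kernel m r z 0 (0 + (-1) * s))"
    by (subst lborel_integral_real_affine[of "-1" _ 0]) auto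
  also have "\<dots> = of_real (pi powr m) * (Gamma (of_real m - z) * exp (- (of_real m - z) * of_real (ln k)))"
    unfolding eq integral_mult_right_zero using LINT_exp_minus_scaled_exp[of "of_real m - z" k] k assms by simp
  also have "ln k = 2 * ln (r / 2)"
    using assms by (simp add: k_def ln_realpow)
  finally show ?thesis by (simp add: mult_ac)
qed

lemma riesz_kernel_measurable [measurable]: "riesz_kernel m r z a \<in> borel_measurable borel"
  unfolding riesz_kernel_def by measurable

lemma LINT_riesz_kernel_tendsto:
  assumes "0 < r" "0 < Re z" "Re z < m" and a: "\<And>k. 0 < a k" "a \<longlonglongrightarrow> 0"
  shows "(\<lambda>k. LINT s|lborel. riesz_kernel m r z (a k) s) \<longlonglongrightarrow> (LINT s|lborel. riesz_kernel m r z 0 s)"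
proof -
  obtain D where D: "0 < D"
    "\<And>z a s. 0 \<le> a \<Longrightarrow> norm (riesz_kernel m r z a s) \<le> D * exp (Re z * s - m * ln (1 + exp s))"
    using norm_riesz_kernel_le[of m r] assms by auto
  show ?thesis
  proof (rule integral_dominated_convergence)
    show "integrable lborel (\<lambda>s. D * exp (Re z * s - m * ln (1 + exp s)))"
      using assms by (intro integrable_mult_right integrable_Beta_kernel_real) auto
    show "AE s in lborel. (\<lambda>k. riesz_kernel m r z (a k) s) \<longlonglongrightarrow> riesz_kernel m r z 0 s"
      unfolding riesz_kernel_def using assms(2,3)
      by (intro AE_I2 tendsto_intros a) (auto simp: add_pos_pos)
  qed (use D less_imp_le[OF a(1)] in auto)
qed

text \<open>Supplies the constant for the majorant in the limit under the integral over y: the bound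
  on the kernel depends on z through its real part only, which is fixed on the contour.\<close>

lemma norm_LINT_riesz_kernel_le:
  assumes "0 < r" "0 < b" "b < m"
  obtains M where "\<And>z a. Re z = b \<Longrightarrow> 0 \<le> a \<Longrightarrow> norm (LINT s|lborel. riesz_kernel m r z a s) \<le> M"
proof -
  obtain D where D: "0 < D"
    "\<And>z a s. 0 \<le> a \<Longrightarrow> norm (riesz_kernel m r z a s) \<le> D * exp (Re z * s - m * ln (1 + exp s))"
    using norm_riesz_kernel_le[of m r] assms by auto
  show thesis
  proof (rule that)
    fix z :: complex and a :: real
    assume z: "Re z = b" and a: "0 \<le> a"
    have i: "integrable lborel (\<lambda>s. D * exp (b * s - m * ln (1 + exp s)))"
      using assms by (intro integrable_mult_right integrable_Beta_kernel_real) auto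
    have n: "norm (riesz_kernel m r z a s) \<le> D * exp (b * s - m * ln (1 + exp s))" for s
      using D(2)[OF a, of z s] z by simp
    have "norm (LINT s|lborel. riesz_kernel m r z a s) \<le> (LINT s|lborel. norm (riesz_kernel m r z a s))"
      by (rule integral_norm_bound)
    also have "\<dots> \<le> (LINT s|lborel. D * exp (b * s - m * ln (1 + exp s)))"
      using n by (intro integral_mono i integrable_norm Bochner_Integration.integrable_bound[OF i])
        (auto intro!: AE_I2 order_trans[OF _ abs_ge_self])
    finally show "norm (LINT s|lborel. riesz_kernel m r z a s) \<le> (LINT s|lborel. D * exp (b * s - m * ln (1 + exp s)))" .
  qed
qed

section \<open>Removal of the damping and the final formula\<close>

text \<open>The formula before normalisation, with \<beta> for \<alpha>/2. The damped inversion
  integral is evaluated in two ways as a k tends to 0: by Fourier inversion it tends to a multiple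
  of p(x), and by Fubini it equals a contour integral of damped Riesz kernels, whose limit is the
  integral of \<open>I\<close>.\<close>

lemma isotropic_density_Mellin_Barnes:
  fixes \<beta> \<nu> c :: real and p :: "'a::euclidean_space \<Rightarrow> real" and x :: 'a
  assumes \<beta>: "0 < \<beta>" "\<beta> < 1" and c: "0 < c" "c < \<nu>" "\<beta> * c < real DIM('a) / 2"
    and p: "integrable lborel p" "isCont p x" and x: "x \<noteq> 0"
    and \<phi>: "\<And>t. (LINT y|lborel. exp (\<i> * complex_of_real (y \<bullet> t)) * complex_of_real (p y)) =
        complex_of_real ((1 + norm t powr (2 * \<beta>)) powr (- \<nu>))"
  defines "m \<equiv> real DIM('a) / 2"
  defines "I \<equiv> (\<lambda>y. Gamma (Complex c y) * Gamma (of_real \<nu> - Complex c y) / Gamma (of_real \<beta> * Complex c y) *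
      (of_real (pi powr m) * Gamma (of_real m - of_real \<beta> * Complex c y) *
       exp ((of_real \<beta> * Complex c y - of_real m) * of_real (2 * ln (norm x / 2)))))"
  shows "integrable lborel I"
    and "(LINT y|lborel. I y) = of_real (2 * pi * Gamma \<nu> * ((2 * pi) ^ DIM('a) * p x))"
proof -
  define z where "z = (\<lambda>y. of_real \<beta> * Complex c y)"
  define G where "G = (\<lambda>y. Gamma (Complex c y) * Gamma (of_real \<nu> - Complex c y))"
  define H where "H = (\<lambda>y. G y / Gamma (z y))"
  define a where "a = (\<lambda>k. inverse (real (Suc k)))"
  define L where "L = (\<lambda>t::'a. complex_of_real (ln ((norm t)\<^sup>2)))"
  define E where "E = (\<lambda>k (t::'a). of_real (exp (- (a k * (norm t)\<^sup>2))) * exp (- \<i> * complex_of_real (x \<bullet> t)))"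
  define K where "K = (\<lambda>k y. LINT s|lborel. riesz_kernel m (norm x) (z y) (a k) s)"
  have a: "\<And>k. 0 < a k" "a \<longlonglongrightarrow> 0"
    unfolding a_def using LIMSEQ_inverse_real_of_nat by auto
  have z: "Re (z y) = \<beta> * c" for y by (simp add: z_def)
  have bc: "0 < \<beta> * c" "\<beta> * c < m" using \<beta> c by (simp_all add: m_def)
  note MB = c(1,2) \<beta>
  have Gi: "integrable lborel G"
    unfolding G_def by (rule integrable_Gamma_Gamma[OF MB])
  have Hi: "integrable lborel H"
    unfolding H_def G_def z_def by (rule integrable_Gamma_Gamma_divide[OF MB])
  have [measurable]: "G \<in> borel_measurable borel" "H \<in> borel_measurable borel" using Gi Hi by auto
  have [measurable]: "z \<in> borel_measurable borel"
    unfolding z_def Complex_eq by measurable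
  have [measurable]: "L \<in> borel_measurable borel" "E k \<in> borel_measurable borel" for k
    unfolding L_def E_def by measurable
  have mellin: "(LINT y|lborel. G y * exp (- z y * L t)) =
      of_real (2 * pi * Gamma \<nu>) * complex_of_real ((1 + norm t powr (2 * \<beta>)) powr (- \<nu>))" if "t \<noteq> 0" for t
  proof -
    have "exp (- z y * L t) = exp (- Complex c y * of_real (\<beta> * ln ((norm t)\<^sup>2)))" for y
      by (simp add: z_def L_def mult_ac)
    moreover have "exp (\<beta> * ln ((norm t)\<^sup>2)) = norm t powr (2 * \<beta>)"
      using that by (simp add: powr_def ln_realpow)
    ultimately show ?thesis
      using Mellin_Barnes_binomial[OF MB, of "\<beta> * ln ((norm t)\<^sup>2)"] by (simp add: G_def)
  qed
  have regularised: "(LINT t|lborel. complex_of_real ((1 + norm t powr (2 * \<beta>)) powr (- \<nu>)) * E k t) * of_real (2 * pi * Gamma \<nu>) =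
      (LINT y|lborel. H y * K k y)" for k
  proof -
    define f where "f = (\<lambda>t y. G y * (exp (- z y * L t) * E k t))"
    \<comment> \<open>The modulus of the damped power depends only on the real exponent \<beta> c.
      Writing it with a trivial character at frequency 0 makes
      \<open>integrable_regularised_riesz\<close> applicable.\<close>
    define R where "R = (\<lambda>t::'a. norm (exp (- of_real (\<beta> * c) * L t) * (of_real (exp (- (a k * (norm t)\<^sup>2))) * exp (- \<i> * complex_of_real (0 \<bullet> t)))))"
    define g where "g = (\<lambda>t y. norm (G y) * R t)"
    have mf: "(\<lambda>(t, y). f t y) \<in> borel_measurable (lborel \<Otimes>\<^sub>M lborel)"
      unfolding f_def by measurable
    have fg: "norm (f t y) \<le> g t y" for t y
      by (simp add: f_def g_def R_def E_def norm_mult z L_def)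
    have gi: "integrable lborel (g t)" for t
      unfolding g_def using Gi by (intro integrable_mult_left integrable_norm)
    have "integrable lborel R"
      unfolding R_def L_def using bc
      by (intro integrable_norm integrable_regularised_riesz a) (auto simp: m_def)
    then have gG: "integrable lborel (\<lambda>t. LINT y|lborel. g t y)"
      unfolding g_def integral_mult_left_zero by (intro integrable_mult_right)
    have ft: "AE t in lborel. (LINT y|lborel. f t y) =
        of_real (2 * pi * Gamma \<nu>) * (complex_of_real ((1 + norm t powr (2 * \<beta>)) powr (- \<nu>)) * E k t)"
      using AE_lborel_singleton[of 0]
    proof eventually_elim
      case (elim t)
      have "(LINT y|lborel. f t y) = (LINT y|lborel. G y * exp (- z y * L t)) * E k t"
        by (simp add: f_def mult.assoc[symmetric])
      then show ?case
        unfolding mellin[OF elim] by simp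
    qed
    have fy: "(LINT t|lborel. f t y) = H y * K k y" for y
      using LINT_regularised_riesz[OF _ _ a(1), of "z y" k x] bc
      by (simp add: f_def E_def L_def H_def K_def z m_def)
    have i: "integrable lborel (\<lambda>t. LINT y|lborel. f t y)"
      by (rule lborel_pair.integrable_fst[OF lborel_Fubini(1)[OF mf fg gi gG]])
    have "(LINT t|lborel. LINT y|lborel. f t y) =
        (LINT t|lborel. of_real (2 * pi * Gamma \<nu>) * (complex_of_real ((1 + norm t powr (2 * \<beta>)) powr (- \<nu>)) * E k t))"
      using i by (intro integral_cong_AE ft) auto
    then show ?thesis
      using lborel_Fubini(2)[OF mf fg gi gG] unfolding fy integral_mult_right_zero by (simp only: mult_ac)
  qed
  have "(\<lambda>k. (LINT t|lborel. complex_of_real ((1 + norm t powr (2 * \<beta>)) powr (- \<nu>)) * E k t) * of_real (2 * pi * Gamma \<nu>))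
      \<longlonglongrightarrow> complex_of_real ((2 * pi) ^ DIM('a) * p x) * of_real (2 * pi * Gamma \<nu>)"
    unfolding E_def by (intro tendsto_mult tendsto_const gaussian_fourier_inversion p \<phi> a)
  then have lim: "(\<lambda>k. LINT y|lborel. H y * K k y) \<longlonglongrightarrow> of_real (2 * pi * Gamma \<nu> * ((2 * pi) ^ DIM('a) * p x))"
    unfolding regularised by (simp add: mult_ac)
  obtain M where M: "\<And>z a. Re z = \<beta> * c \<Longrightarrow> 0 \<le> a \<Longrightarrow> norm (LINT s|lborel. riesz_kernel m (norm x) z a s) \<le> M"
    using norm_LINT_riesz_kernel_le[of "norm x" "\<beta> * c" m] bc x by auto
  \<comment> \<open>The integrand of the claim is the case a = 0 of the damped one, so the
    convergence of the kernels gives pointwise convergence in y.\<close>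
  have I: "I = (\<lambda>y. H y * (LINT s|lborel. riesz_kernel m (norm x) (z y) 0 s))"
    using LINT_riesz_kernel_0[of "norm x" _ m] bc x by (auto simp: I_def H_def G_def z z_def)
  have mK: "(\<lambda>y. LINT s|lborel. riesz_kernel m (norm x) (z y) b s) \<in> borel_measurable lborel" for b
    unfolding riesz_kernel_def by measurable
  have m1: "I \<in> borel_measurable lborel"
    unfolding I using mK[of 0] by measurable
  have m2: "(\<lambda>y. H y * K k y) \<in> borel_measurable lborel" for k
    unfolding K_def using mK[of "a k"] by measurable
  have w: "integrable lborel (\<lambda>y. norm (H y) * M)"
    using Hi by (intro integrable_mult_left integrable_norm)
  have ptw: "AE y in lborel. (\<lambda>k. H y * K k y) \<longlonglongrightarrow> I y"
    unfolding I K_def using bc x by (intro AE_I2 tendsto_intros LINT_riesz_kernel_tendsto a) (auto simp: z)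
  have dom: "AE y in lborel. norm (H y * K k y) \<le> norm (H y) * M" for k
    unfolding norm_mult K_def using a(1)[of k] by (intro AE_I2 mult_left_mono M z) auto
  show "integrable lborel I"
    by (rule integrable_dominated_convergence[OF m1 m2 w ptw dom])
  have "(\<lambda>k. LINT y|lborel. H y * K k y) \<longlonglongrightarrow> (LINT y|lborel. I y)"
    by (rule integral_dominated_convergence[OF m1 m2 w ptw dom])
  then show "(LINT y|lborel. I y) = of_real (2 * pi * Gamma \<nu> * ((2 * pi) ^ DIM('a) * p x))"
    using lim by (rule LIMSEQ_unique)
qed

section \<open>Specialisation to \<open>real ^ 'n\<close> and comparison of constants\<close>

theorem proposition3p8:
  fixes \<alpha> \<nu> c r :: real and p :: "real ^ 'n \<Rightarrow> real" and x :: "real ^ 'n"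
  assumes "0 < \<alpha>" and "\<alpha> < 2" and "0 < \<nu>"
    and "is_linnik_density \<alpha> \<nu> p"
    and "0 < c" and "c < min \<nu> (1 / \<alpha>)"
    and "0 < r" and "norm x = r"
  shows "vertical_line_integrable c (linnik_integrand \<alpha> \<nu> CARD('n) r) \<and>
    complex_of_real (p x) =
      complex_of_real (r powr (- real CARD('n)) / (pi powr (real CARD('n) / 2) * Gamma \<nu>)) *
      (1 / (2 * complex_of_real pi * \<i>) *
        vertical_line_integral c (linnik_integrand \<alpha> \<nu> CARD('n) r))"
proof -
  define n where "n = real CARD('n)"
  define f where "f = (\<lambda>y. linnik_integrand \<alpha> \<nu> CARD('n) r (Complex c y))"
  have n1: "1 \<le> n" using zero_less_card_finite[where 'a='n] by (simp add: n_def)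
  \<comment> \<open>From c < 1/\<alpha> follows \<alpha> c < 1 \<le> n, so the exponent \<alpha> c /
    2 lies below half the dimension.\<close>
  have ac: "\<alpha> * c < n"
    using assms n1 by (auto simp: field_simps intro: less_le_trans)
  have cond: "0 < \<alpha> / 2" "\<alpha> / 2 < 1" "c < \<nu>" "\<alpha> / 2 * c < real DIM(real ^ 'n) / 2"
    using assms ac by (auto simp: n_def)
  have x: "x \<noteq> 0" using assms by auto
  have pos: "0 < Gamma \<nu>" using assms by (simp add: Gamma_real_pos)
  have \<phi>: "(LINT y|lborel. exp (\<i> * complex_of_real (y \<bullet> t)) * complex_of_real (p y)) =
        complex_of_real ((1 + norm t powr (2 * (\<alpha> / 2))) powr (- \<nu>))" for t
    using assms(4) by (simp add: is_linnik_density_def)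
  \<comment> \<open>The characteristic function at 0 equals 1, whereas a function that is not
    integrable has integral 0 by convention.\<close>
  have pint: "integrable lborel p"
    using \<phi>[of 0] not_integrable_integral_eq[of lborel p] by fastforce
  have cont: "isCont p x"
    using assms(4) x by (auto simp: is_linnik_density_def continuous_on_eq_continuous_at open_Compl)
  \<comment> \<open>The part of the Riesz kernels that is constant along the contour; the remaining
    power of r/2 belongs to the integrand of the claim.\<close>
  define C where "C = pi powr (n / 2) * (r / 2) powr (- n)"
  have C: "0 < C" using assms by (simp add: C_def)
  note aux = isotropic_density_Mellin_Barnes[OF cond(1,2) assms(5) cond(3,4) pint cont x \<phi>]
  have If: "Gamma (Complex c y) * Gamma (of_real \<nu> - Complex c y) / Gamma (of_real (\<alpha> / 2) * Complex c y) *
      (of_real (pi powr (real DIM(real ^ 'n) / 2)) * Gamma (of_real (real DIM(real ^ 'n) / 2) - of_real (\<alpha> / 2) * Complex c y) *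
       exp ((of_real (\<alpha> / 2) * Complex c y - of_real (real DIM(real ^ 'n) / 2)) * of_real (2 * ln (norm x / 2)))) = of_real C * f y" for y
  proof -
    have e: "exp ((of_real (\<alpha> / 2) * w - of_real (real DIM(real ^ 'n) / 2)) * complex_of_real (2 * ln (norm x / 2))) =
        complex_of_real (r / 2) powr (of_real \<alpha> * w) * of_real ((r / 2) powr (- n))" for w
    proof -
      have "(of_real (\<alpha> / 2) * w - of_real (n / 2)) * complex_of_real (2 * l) = of_real \<alpha> * w * of_real l + of_real (- n * l)" for l
        by (simp add: algebra_simps)
      moreover have "exp (complex_of_real (- n * ln (r / 2))) = of_real ((r / 2) powr (- n))"
        unfolding exp_of_real using assms(7) by (simp add: powr_def)
      moreover have "exp (of_real \<alpha> * w * of_real (ln (r / 2))) = complex_of_real (r / 2) powr (of_real \<alpha> * w)"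
        using assms(7) by (simp add: powr_def Ln_of_real del: of_real_divide)
      ultimately show ?thesis
        using assms(8) by (simp only: exp_add n_def DIM_cart DIM_real mult_1_right)
    qed
    have g1: "complex_of_real (\<alpha> / 2) * w = of_real \<alpha> * w / 2"
      and g2: "of_real (real DIM(real ^ 'n) / 2) - of_real \<alpha> * w / 2 = (of_nat CARD('n) - of_real \<alpha> * w) / 2" for w
      by (simp_all add: diff_divide_distrib)
    have d: "DIM(real ^ 'n) = CARD('n)" by simp
    show ?thesis
      unfolding e unfolding g1 unfolding g2 unfolding f_def linnik_integrand_def C_def n_def d
      by (simp only: of_real_mult times_divide_eq_left times_divide_eq_right mult_ac)
  qed
  note aux' = aux[unfolded If]
  have fi: "integrable lborel f"
    using integrable_mult_right[OF aux'(1), of "1 / of_real C"] C by simp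
  have "of_real C * (LINT y|lborel. f y) = complex_of_real (2 * pi * Gamma \<nu> * ((2 * pi) ^ CARD('n) * p x))"
    using aux'(2) by simp
  then have "of_real (p x) = of_real (C / (2 * pi * Gamma \<nu> * (2 * pi) ^ CARD('n))) * (LINT y|lborel. f y)"
    using pos by (simp add: field_simps)
  \<comment> \<open>The 2^n from (r/2)^(-n) cancels that of (2 pi)^n, and one of the two factors
    pi^(n/2) of pi^n cancels too.\<close>
  also have "C / (2 * pi * Gamma \<nu> * (2 * pi) ^ CARD('n)) = r powr (- n) / (pi powr (n / 2) * Gamma \<nu>) * (1 / (2 * pi))"
  proof -
    have "(2 * pi) ^ CARD('n) = 2 powr n * (pi powr (n / 2) * pi powr (n / 2))"
      by (simp add: n_def power_mult_distrib powr_realpow flip: powr_add)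
    moreover have "C = pi powr (n / 2) * (r powr (- n) * 2 powr n)"
      using assms(7) by (simp add: C_def powr_divide powr_minus field_simps)
    ultimately show ?thesis
      by (simp add: field_simps)
  qed
  finally have "of_real (p x) = of_real (r powr (- n) / (pi powr (n / 2) * Gamma \<nu>)) * (of_real (1 / (2 * pi)) * (LINT y|lborel. f y))"
    by simp
  \<comment> \<open>The factor i in \<open>vertical_line_integral\<close> cancels the one in 1 / (2
    pi i).\<close>
  then show ?thesis
    using fi by (simp add: vertical_line_integrable_def vertical_line_integral_def f_def n_def)
qed

end
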